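(* Let $k\ge1$ and let $i_1,\dots,i_k$ be nonnegative integers. For every positive integer $N$, $$p_{i_1,\dots,i_k}(N)=I^N_{i_1,\dots,i_k}:=\frac{\int_{\mathfrak h_N}\mathrm{Tr}(X^{i_1})\mathrm{Tr}(X^{i_2})\cdots\mathrm{Tr}(X^{i_k})\,e^{-\frac12\mathrm{Tr}(X^2)}\,dX}{\int_{\mathfrak h_N}e^{-\frac12\mathrm{Tr}(X^2)}\,dX},$$ where $p_{i_1,\dots,i_k}(\nu)\in\mathbb C[\nu]$ is the unique polynomial in $\nu$ representing the cohomology class of the cocycle $(x^{i_1})(x^{i_2})\cdots(x^{i_k})$ in the complex $\mathrm P^{\mathrm{nc}}_{\hbar=1}[\Sigma\mathcal A]$.
   Context: $\mathfrak h_N$ is the real vector space of Hermitian $N\times N$ complex matrices and $dX$ is Lebesgue measure. $\mathcal A$ is the two-dimensional complex with basis $a$ (degree 1), $b$ (degree 2), symmetric pairing $\langle a,b\rangle=1$, differential $da=b$, viewed as a cyclic $A_\infty$-algebra with zero multiplication and higher operations. $(\Sigma\mathcal A)^*$ has basis $x$ of degree $0$ and $\xi$ of degree $-1$ (up to sign dual to $a$ and $b$), with inverse pairing $\langle x,\xi\rangle^{-1}=\langle\xi,x\rangle^{-1}=1$ (other pairings zero), and dual differential $d\xi=-x$, $dx=0$. $\mathrm H[\Sigma\mathcal A]=\bigoplus_{k\ge0}[((\Sigma\mathcal A)^* )^{\otimes k}]_{\mathbb Z/k}$ is the space of cyclic words in $x,\xi$ (coinvariants with Koszul signs); the empty word is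 denoted $\nu$ and $x^i$ denotes the cyclic word $x\cdots x$ of length $i$ (so $x^0=\nu$). It has bracket $$\{(a_1\cdots a_m),(b_1\cdots b_n)\}=\sum_{i,j}\pm\langle a_i,b_j\rangle^{-1}(a_{i+1}\cdots a_ma_1\cdots a_{i-1}b_{j+1}\cdots b_nb_1\cdots b_{j-1})$$ and cobracket $$\nabla(a_1\cdots a_n)=\sum_{i<j}\pm\langle a_i,a_j\rangle^{-1}(a_{i+1}\cdots a_{j-1})(a_{j+1}\cdots a_na_1\cdots a_{i-1}),$$ with Koszul signs. $\mathrm P^{\mathrm{nc}}_{\hbar=1}[\Sigma\mathcal A]$ is the graded symmetric algebra $S(\mathrm H[\Sigma\mathcal A])=\mathbb C[\nu]\otimes S(\mathrm H_+[\Sigma\mathcal A])$ ($\mathrm H_+$ spanned by nonempty words) with differential $d+\delta+\nabla$, where $d$ and $\nabla$ are extended as derivations and $\delta(w_1\cdots w_n)=\sum_{i<j}\pm\{w_i,w_j\}w_1\cdots\widehat{w_i}\cdots\widehat{w_j}\cdots w_n$ for $w_i\in\mathrm H[\Sigma\mathcal A]$. The inclusion $\mathbb C[\nu]\to\mathrm P^{\mathrm{nc}}_{\hbar=1}[\Sigma\mathcal A]$ ($\mathbb C[\nu]$ with zero differential) is a quasi-isomorphism, so every cohomology class is represented by a unique polynomial in $\nu$; every product $(x^{i_1})\cdots(x^{i_k})$ is a cocycle. *)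

theory Defs
  imports
    "HOL-Analysis.Analysis"
    "HOL-Library.Poly_Mapping"
    "HOL-Computational_Algebra.Polynomial"
    "Jordan_Normal_Form.Schur_Decomposition"
begin

section \<open>The complex of products of cyclic words\<close>

text \<open>
  The basis \<open>x\<close> (degree 0), \<open>\<xi>\<close> (degree -1) of the dual of the suspension of the
  two-dimensional cyclic algebra.
\<close>

datatype letter = x_letter | xi_letter

type_synonym word = "letter list"

text \<open>
  The graded symmetric algebra on the cyclic words is a quotient of the tensor algebra on
  \<open>\<Oplus>\<^sub>k V\<^sup>\<otimes>\<^sup>k\<close>, the vector space with basis the lists of (non-cyclic) words; the list
  \<open>[w\<^sub>1, \<dots>, w\<^sub>n]\<close> stands for the product \<open>(w\<^sub>1)\<cdots>(w\<^sub>n)\<close> and the word \<open>[]\<close> for \<open>\<nu>\<close>.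
  All operations are given by formulas on this tensor algebra; the quotient is taken by
  \<open>relations\<close> below.
\<close>

type_synonym tensor = "word list \<Rightarrow>\<^sub>0 complex"

fun letter_degree :: "letter \<Rightarrow> int" where
  "letter_degree x_letter = 0"
| "letter_degree xi_letter = - 1"

definition word_degree :: "word \<Rightarrow> int" where
  "word_degree w = sum_list (map letter_degree w)"

definition list_degree :: "word list \<Rightarrow> int" where
  "list_degree ws = sum_list (map word_degree ws)"

definition sign :: "int \<Rightarrow> complex" where
  "sign n = (if even n then 1 else - 1)"

fun inverse_pairing :: "letter \<Rightarrow> letter \<Rightarrow> complex" where
  "inverse_pairing x_letter xi_letter = 1"
| "inverse_pairing xi_letter x_letter = 1"
| "inverse_pairing _ _ = 0"

text \<open>\<open>dual_differential a b\<close> is the coefficient of \<open>b\<close> in \<open>d a\<close>: \<open>d \<xi> = - x\<close> and \<open>d x = 0\<close>.\<close>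

fun dual_differential :: "letter \<Rightarrow> letter \<Rightarrow> complex" where
  "dual_differential xi_letter x_letter = - 1"
| "dual_differential _ _ = 0"

definition scale :: "complex \<Rightarrow> tensor \<Rightarrow> tensor" where
  "scale c t = Poly_Mapping.map ((*) c) t"

lemma lookup_scale [simp]: "Poly_Mapping.lookup (scale c t) ws = c * Poly_Mapping.lookup t ws"
  by (simp add: scale_def Poly_Mapping.map.rep_eq when_def)

global_interpretation tensor: vector_space scale
  by unfold_locales
    (auto intro!: poly_mapping_eqI simp: lookup_add algebra_simps)

definition linear_extension :: "(word list \<Rightarrow> tensor) \<Rightarrow> tensor \<Rightarrow> tensor" where
  "linear_extension f t =
     (\<Sum>ws\<in>Poly_Mapping.keys t. scale (Poly_Mapping.lookup t ws) (f ws))"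

definition monomial :: "word list \<Rightarrow> tensor" where
  "monomial ws = Poly_Mapping.single ws 1"

definition multiply_between :: "word list \<Rightarrow> tensor \<Rightarrow> word list \<Rightarrow> tensor" where
  "multiply_between us t vs = linear_extension (\<lambda>ws. monomial (us @ ws @ vs)) t"

definition word_differential :: "word \<Rightarrow> tensor" where
  "word_differential w =
     (\<Sum>i<length w. \<Sum>b\<in>{x_letter, xi_letter}.
        scale (sign (word_degree (take i w)) * dual_differential (w ! i) b)
          (monomial [take i w @ [b] @ drop (Suc i) w]))"

text \<open>
  Koszul signs of the cobracket: write \<open>w = p a u b q\<close> with \<open>a\<close>, \<open>b\<close> the letters that are
  paired. Rotating \<open>w\<close> to \<open>a u b q p\<close> gives the first sign, moving \<open>b\<close> to the left past \<open>u\<close>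
  gives the second one; then \<open>a b\<close> is contracted and \<open>u\<close>, \<open>q p\<close> remain.
\<close>

definition cobracket :: "word \<Rightarrow> tensor" where
  "cobracket w =
     (\<Sum>j<length w. \<Sum>i<j.
        let p = take i w; u = drop (Suc i) (take j w); q = drop (Suc j) w in
        scale (sign (word_degree p * word_degree (drop i w)) *
               sign (letter_degree (w ! j) * word_degree u) *
               inverse_pairing (w ! i) (w ! j))
          (monomial [u, q @ p]))"

text \<open>
  Koszul signs of the bracket: rotate \<open>v = v' a v''\<close> to \<open>A a\<close> with \<open>A = v'' v'\<close> and
  \<open>w = w' b w''\<close> to \<open>b B\<close> with \<open>B = w'' w'\<close>; the contraction of \<open>a b\<close> in \<open>A a b B\<close> has
  degree 1 and so passes \<open>A\<close> at the cost of the last sign.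
\<close>

definition bracket :: "word \<Rightarrow> word \<Rightarrow> tensor" where
  "bracket v w =
     (\<Sum>i<length v. \<Sum>j<length w.
        let A = drop (Suc i) v @ take i v; B = drop (Suc j) w @ take j w in
        scale (sign (word_degree (take (Suc i) v) * word_degree (drop (Suc i) v)) *
               sign (word_degree (take j w) * word_degree (drop j w)) *
               sign (word_degree A) *
               inverse_pairing (v ! i) (w ! j))
          (monomial [A @ B]))"

definition derivation_extension :: "(word \<Rightarrow> tensor) \<Rightarrow> word list \<Rightarrow> tensor" where
  "derivation_extension f ws =
     (\<Sum>i<length ws. scale (sign (list_degree (take i ws)))
        (multiply_between (take i ws) (f (ws ! i)) (drop (Suc i) ws)))"

text \<open>The sign is that of moving the \<open>i\<close>-th and then the \<open>j\<close>-th factor to the front.\<close>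

definition delta :: "word list \<Rightarrow> tensor" where
  "delta ws =
     (\<Sum>j<length ws. \<Sum>i<j.
        scale (sign (word_degree (ws ! i) * list_degree (take i ws)) *
               sign (word_degree (ws ! j) *
                 (list_degree (take i ws) + list_degree (drop (Suc i) (take j ws)))))
          (multiply_between [] (bracket (ws ! i) (ws ! j))
             (take i ws @ drop (Suc i) (take j ws) @ drop (Suc j) ws)))"

definition total_differential :: "tensor \<Rightarrow> tensor" where
  "total_differential =
     linear_extension (\<lambda>ws. derivation_extension word_differential ws + delta ws +
       derivation_extension cobracket ws)"

text \<open>
  The relations that pass from the tensor algebra to the graded symmetric algebra on the cyclic
  words: cyclic rotation of one factor and transposition of two neighbouring factors, both with
  Koszul signs. \<open>total_differential\<close> maps this subspace to itself and squares to zero modulo it.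
\<close>

definition relations :: "tensor set" where
  "relations = tensor.span
     ({monomial (us @ [a # w] @ vs) -
         scale (sign (letter_degree a * word_degree w)) (monomial (us @ [w @ [a]] @ vs))
         | us a w vs. True} \<union>
      {monomial (us @ [v, w] @ vs) -
         scale (sign (word_degree v * word_degree w)) (monomial (us @ [w, v] @ vs))
         | us v w vs. True})"

text \<open>
  Equality of cohomology classes of two cocycles of the quotient complex, in terms of
  representatives in the tensor algebra.
\<close>

definition cohomologous :: "tensor \<Rightarrow> tensor \<Rightarrow> bool" where
  "cohomologous s t \<longleftrightarrow> (\<exists>y. s - t - total_differential y \<in> relations)"

definition nu_polynomial :: "complex poly \<Rightarrow> tensor" where
  "nu_polynomial p = (\<Sum>k\<le>degree p. scale (coeff p k) (monomial (replicate k [])))"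

definition x_product :: "nat list \<Rightarrow> tensor" where
  "x_product ks = monomial (map (\<lambda>k. replicate k x_letter) ks)"

definition class_polynomial :: "nat list \<Rightarrow> complex poly" where
  "class_polynomial ks = (THE p. cohomologous (nu_polynomial p) (x_product ks))"

section \<open>Gaussian integrals over Hermitian matrices\<close>

definition hermitian_matrices :: "nat \<Rightarrow> complex mat set" where
  "hermitian_matrices N = {A \<in> carrier_mat N N. mat_adjoint A = A}"

text \<open>
  Real linear coordinates: \<open>m (i, i)\<close> is the \<open>i\<close>-th diagonal entry, and for \<open>i < j\<close> the real
  and imaginary parts of the entry at \<open>(i, j)\<close> are \<open>m (i, j)\<close> and \<open>m (j, i)\<close>. The Lebesgue
  measure is normalised by these coordinates; the normalisation cancels in \<open>gaussian_moment\<close>.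
\<close>

definition hermitian_of_coords :: "nat \<Rightarrow> (nat \<times> nat \<Rightarrow> real) \<Rightarrow> complex mat" where
  "hermitian_of_coords N m = mat N N (\<lambda>(i, j).
     if i = j then Complex (m (i, i)) 0
     else if i < j then Complex (m (i, j)) (m (j, i))
     else Complex (m (j, i)) (- m (i, j)))"

definition hermitian_lebesgue :: "nat \<Rightarrow> complex mat measure" where
  "hermitian_lebesgue N =
     embed_measure (Pi\<^sub>M ({..<N} \<times> {..<N}) (\<lambda>_. lborel)) (hermitian_of_coords N)"

lemma bij_betw_hermitian_of_coords:
  "bij_betw (hermitian_of_coords N) ({..<N} \<times> {..<N} \<rightarrow>\<^sub>E UNIV) (hermitian_matrices N)"
proof -
  have adj: "mat_adjoint A = A \<longleftrightarrow> (\<forall>i<N. \<forall>j<N. A $$ (i, j) = cnj (A $$ (j, i)))"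
    if "A \<in> carrier_mat N N" for A :: "complex mat"
  proof -
    have entry: "mat_adjoint A $$ (i, j) = cnj (A $$ (j, i))" if "i < N" "j < N" for i j
      using that \<open>A \<in> carrier_mat N N\<close>
      unfolding mat_adjoint_def mat_of_rows_def by (simp add: conjugate_vec_def)
    have dims: "dim_row (mat_adjoint A) = N" "dim_col (mat_adjoint A) = N"
      "dim_row A = N" "dim_col A = N"
      using that unfolding mat_adjoint_def mat_of_rows_def by auto
    have "mat_adjoint A = A \<longleftrightarrow> (\<forall>i<N. \<forall>j<N. mat_adjoint A $$ (i, j) = A $$ (i, j))"
      unfolding mat_eq_iff dims by simp
    also have "\<dots> \<longleftrightarrow> (\<forall>i<N. \<forall>j<N. A $$ (i, j) = cnj (A $$ (j, i)))"
      by (intro all_cong1 imp_cong refl) (simp only: entry eq_commute)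
    finally show ?thesis .
  qed
  have inj: "m = m'"
    if m: "m \<in> {..<N} \<times> {..<N} \<rightarrow>\<^sub>E (UNIV :: real set)"
      and m': "m' \<in> {..<N} \<times> {..<N} \<rightarrow>\<^sub>E (UNIV :: real set)"
      and eq: "hermitian_of_coords N m = hermitian_of_coords N m'" for m m'
  proof (rule PiE_ext[OF m m'])
    fix p :: "nat \<times> nat" assume p: "p \<in> {..<N} \<times> {..<N}"
    obtain i j where ij: "p = (i, j)" "i < N" "j < N" using p by auto
    have "hermitian_of_coords N m $$ (i, j) = hermitian_of_coords N m' $$ (i, j)"
      and "hermitian_of_coords N m $$ (j, i) = hermitian_of_coords N m' $$ (j, i)"
      by (simp_all add: eq)
    then show "m p = m' p"
      using ij by (auto simp: hermitian_of_coords_def split: if_splits)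
  qed
  have sub: "hermitian_of_coords N m \<in> hermitian_matrices N" for m
  proof -
    have "hermitian_of_coords N m \<in> carrier_mat N N"
      by (simp add: hermitian_of_coords_def)
    then show ?thesis
      by (auto simp: hermitian_matrices_def adj) (auto simp: hermitian_of_coords_def complex_eq_iff)
  qed
  have surj: "\<exists>m \<in> {..<N} \<times> {..<N} \<rightarrow>\<^sub>E UNIV. A = hermitian_of_coords N m"
    if A: "A \<in> hermitian_matrices N" for A
  proof -
    have c: "A \<in> carrier_mat N N" using A by (simp add: hermitian_matrices_def)
    then have h: "A $$ (i, j) = cnj (A $$ (j, i))" if "i < N" "j < N" for i j
      using A adj[OF c] that unfolding hermitian_matrices_def by blast
    define m where "m = restrict (\<lambda>(i, j). if i \<le> j then Re (A $$ (i, j)) else Im (A $$ (j, i)))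
      ({..<N} \<times> {..<N})"
    have "A = hermitian_of_coords N m"
    proof (rule eq_matI)
      fix i j assume "i < dim_row (hermitian_of_coords N m)" "j < dim_col (hermitian_of_coords N m)"
      then have ij: "i < N" "j < N" by (simp_all add: hermitian_of_coords_def)
      show "A $$ (i, j) = hermitian_of_coords N m $$ (i, j)"
      proof -
        have entry: "hermitian_of_coords N m $$ (i, j) =
            (if i = j then Complex (Re (A $$ (i, i))) 0
             else if i < j then A $$ (i, j) else cnj (A $$ (j, i)))"
          using ij by (auto simp: hermitian_of_coords_def m_def complex_eq_iff)
        consider "i = j" | "i < j" | "j < i" by linarith
        then show ?thesis
        proof cases
          case 1
          have "Im (A $$ (i, i)) = - Im (A $$ (i, i))"
            using arg_cong[OF h[OF ij(1) ij(1)], of Im] by simp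
          then have "A $$ (i, i) = Complex (Re (A $$ (i, i))) 0" by (simp add: complex_eq_iff)
          moreover have "hermitian_of_coords N m $$ (i, j) = Complex (Re (A $$ (i, i))) 0"
            using entry 1 by simp
          ultimately show ?thesis using 1 by metis
        next
          case 2
          then show ?thesis by (simp add: entry)
        next
          case 3
          then show ?thesis using h[OF ij] by (simp only: entry) simp
        qed
      qed
    qed (use c in \<open>auto simp: hermitian_of_coords_def\<close>)
    moreover have "m \<in> {..<N} \<times> {..<N} \<rightarrow>\<^sub>E UNIV" by (simp add: m_def)
    ultimately show ?thesis by blast
  qed
  show ?thesis
    unfolding bij_betw_def inj_on_def using inj sub surj by blast
qed

lemma space_hermitian_lebesgue: "space (hermitian_lebesgue N) = hermitian_matrices N"
  using bij_betw_imp_surj_on[OF bij_betw_hermitian_of_coords, of N]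
  by (simp add: hermitian_lebesgue_def space_embed_measure space_PiM)

definition mat_trace :: "complex mat \<Rightarrow> complex" where
  "mat_trace A = (\<Sum>i<dim_row A. A $$ (i, i))"

definition gaussian_moment :: "nat \<Rightarrow> nat list \<Rightarrow> complex" where
  "gaussian_moment N ks =
     (LINT A|hermitian_lebesgue N.
        (\<Prod>k\<leftarrow>ks. mat_trace (A ^\<^sub>m k)) * exp (- (1 / 2) * mat_trace (A ^\<^sub>m 2))) /
     (LINT A|hermitian_lebesgue N. exp (- (1 / 2) * mat_trace (A ^\<^sub>m 2)))"

end

(* The proof evaluates the complex by random matrices. For each N there is a linear functional on
   tensors sending (x^{i_1})...(x^{i_k}) to the Gaussian moment I^N and every product of words
   containing xi to 0. Gaussian integration by parts (the Schwinger-Dyson or loop equations for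
   Tr X^{m+1} Tr X^{k_1} ... Tr X^{k_r}) says exactly that the functional vanishes on the
   differential of a product with one xi: there d gives the left-hand side, the cobracket splits
   the trace and the bracket merges two traces. Hence the functional descends to cohomology, and a
   polynomial in nu is sent to its value at N, so the representing polynomial is unique and has
   the stated values. Solving the same equations for the term produced by d reduces the
   number of letters, which gives existence of the representing polynomial. *)

theory Submission
  imports Defs "HOL-Probability.Distributions"
begin

section \<open>The differential on products of cyclic words\<close>

text \<open>Existence and uniqueness of the representing polynomial are proved directly, without a
  quasi-isomorphism, and every calculation with the differential takes place in the tensor algebra
  before the quotient. This works because in a product with a single xi all other letters have
  degree 0, so every Koszul sign is 1 and the differential becomes an explicit identity between
  tensors. On the matrix side the obstacle is that the loop equations need integration by parts in a
  matrix entry, whereas the integral runs over real coordinates with unequal variances. Means are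
  therefore taken against a product of one-variable normal densities. There integration by parts is
  a recursion for moments, extends linearly to polynomial functions, and the two coordinate
  derivatives belonging to an entry are combined with complex coefficients. When traces merge, the
  exponent k - 1 is a truncated subtraction; it always comes with the factor k, so k = 0 contributes
  nothing.\<close>

lemma linear_extension_superset:
  assumes "finite K" "Poly_Mapping.keys t \<subseteq> K"
  shows "linear_extension f t = (\<Sum>ws\<in>K. scale (Poly_Mapping.lookup t ws) (f ws))"
  unfolding linear_extension_def using assms
  by (intro sum.mono_neutral_left) (auto simp: in_keys_iff)

lemma linear_linear_extension: "Vector_Spaces.linear scale scale (linear_extension f)"
proof (intro Vector_Spaces.linear_iff[THEN iffD2] conjI allI)
  fix s t :: tensor and c :: complex
  let ?K = "Poly_Mapping.keys s \<union> Poly_Mapping.keys t \<union> Poly_Mapping.keys (s + t) \<union>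
    Poly_Mapping.keys (scale c s)"
  have K: "linear_extension f u = (\<Sum>ws\<in>?K. scale (Poly_Mapping.lookup u ws) (f ws))"
    if "u \<in> {s, t, s + t, scale c s}" for u
    using that by (intro linear_extension_superset) auto
  show "linear_extension f (s + t) = linear_extension f s + linear_extension f t"
    by (simp add: K lookup_add tensor.scale_left_distrib sum.distrib)
  show "linear_extension f (scale c s) = scale c (linear_extension f s)"
    by (simp add: K tensor.scale_sum_right)
qed (rule tensor.vector_space_axioms)+

interpretation linear_extension: Vector_Spaces.linear scale scale "linear_extension f" for f
  by (rule linear_linear_extension)

lemma lookup_monomial: "Poly_Mapping.lookup (monomial ws) vs = (if vs = ws then 1 else 0)"
  by (simp add: monomial_def lookup_single when_def)

lemma keys_monomial [simp]: "Poly_Mapping.keys (monomial ws) = {ws}"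
  by (simp add: monomial_def)

lemma linear_extension_monomial [simp]: "linear_extension f (monomial ws) = f ws"
  by (simp add: linear_extension_def lookup_monomial)

lemma linear_multiply_between:
  "Vector_Spaces.linear scale scale (\<lambda>t. multiply_between us t vs)"
  unfolding multiply_between_def by (rule linear_linear_extension)

interpretation multiply_between: Vector_Spaces.linear scale scale "\<lambda>t. multiply_between us t vs"
  for us vs by (rule linear_multiply_between)

lemma multiply_between_monomial [simp]:
  "multiply_between us (monomial ws) vs = monomial (us @ ws @ vs)"
  by (simp add: multiply_between_def)

interpretation total_differential: Vector_Spaces.linear scale scale total_differential
  unfolding total_differential_def by (rule linear_linear_extension)

lemma total_differential_monomial:
  "total_differential (monomial ws) = derivation_extension word_differential ws + delta ws +
     derivation_extension cobracket ws"
  by (simp add: total_differential_def)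

lemma sum_lessThan_add:
  fixes f :: "nat \<Rightarrow> 'a::comm_monoid_add"
  shows "sum f {..<m + n} = sum f {..<m} + (\<Sum>i<n. f (m + i))"
  by (induction n) (simp_all add: ac_simps)

lemma sum_eq_at:
  fixes f :: "'b \<Rightarrow> 'a::comm_monoid_add"
  assumes "finite A" "k \<in> A" "\<And>i. i \<in> A \<Longrightarrow> i \<noteq> k \<Longrightarrow> f i = 0"
  shows "sum f A = f k"
  using assms by (simp add: sum.remove)

text \<open>The pairs i < j that meet a given index P form a hook: those with j = P and those with i
  = P. Here P is the position of the only xi in a word, or of the only factor containing xi;
  contractions away from it vanish.\<close>

lemma sum_triangle_hook:
  fixes F :: "nat \<Rightarrow> nat \<Rightarrow> 'a::comm_monoid_add"
  assumes "\<And>i j. i < j \<Longrightarrow> j < Suc (P + n) \<Longrightarrow> i \<noteq> P \<Longrightarrow> j \<noteq> P \<Longrightarrow> F i j = 0"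
  shows "(\<Sum>j<Suc (P + n). \<Sum>i<j. F i j) = (\<Sum>i<P. F i P) + (\<Sum>t<n. F P (Suc (P + t)))"
proof -
  have "(\<Sum>j<P. \<Sum>i<j. F i j) = 0"
    using assms by (intro sum.neutral ballI) auto
  moreover have "(\<Sum>i<Suc (P + t). F i (Suc (P + t))) = F P (Suc (P + t))" if "t < n" for t
    using that assms by (intro sum_eq_at) auto
  ultimately show ?thesis
    using sum_lessThan_add[of "\<lambda>j. \<Sum>i<j. F i j" "Suc P" n] by simp
qed

section \<open>The differential on products with at most one xi\<close>

abbreviation x_word :: "nat \<Rightarrow> word" where
  "x_word k \<equiv> replicate k x_letter"

abbreviation xi_word :: "nat \<Rightarrow> nat \<Rightarrow> word" where
  "xi_word a b \<equiv> x_word a @ xi_letter # x_word b"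

lemma sign_0 [simp]: "sign 0 = 1"
  by (simp add: sign_def)

lemma word_degree_simps [simp]:
  "word_degree [] = 0"
  "word_degree (a # w) = letter_degree a + word_degree w"
  "word_degree (v @ w) = word_degree v + word_degree w"
  by (simp_all add: word_degree_def)

lemma word_degree_x_word [simp]: "word_degree (x_word k) = 0"
  by (induction k) simp_all

lemma list_degree_simps [simp]:
  "list_degree [] = 0"
  "list_degree (w # ws) = word_degree w + list_degree ws"
  "list_degree (vs @ ws) = list_degree vs + list_degree ws"
  by (simp_all add: list_degree_def)

lemma list_degree_x_words [simp]: "list_degree (map x_word ks) = 0"
  by (induction ks) simp_all

lemma inverse_pairing_same [simp]: "inverse_pairing a a = 0"
  by (cases a) simp_all

lemma nth_xi_word:
  assumes "i \<le> a + b"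
  shows "xi_word a b ! i = (if i = a then xi_letter else x_letter)"
  using assms by (auto simp: nth_append nth_Cons')

lemma take_drop_xi_word:
  "i \<le> a \<Longrightarrow> take i (xi_word a b) = x_word i"
  "drop (Suc (a + t)) (xi_word a b) = x_word (b - t)"
  "drop (Suc a) (xi_word a b) = x_word b"
  by (simp_all add: min_def)

lemma word_differential_x_word [simp]: "word_differential (x_word k) = 0"
  unfolding word_differential_def by (intro sum.neutral) auto

text \<open>The letters in front of xi have degree 0, so no Koszul sign appears. The minus sign is
  that of d xi = - x, the only one that survives in \<open>total_differential_xi\<close>.\<close>

lemma word_differential_xi_word:
  "word_differential (xi_word a b) = - monomial [x_word (Suc (a + b))]"
proof -
  have "word_differential (xi_word a b) =
    (\<Sum>c\<in>{x_letter, xi_letter}.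
        scale (sign (word_degree (take a (xi_word a b))) * dual_differential (xi_word a b ! a) c)
          (monomial [take a (xi_word a b) @ [c] @ drop (Suc a) (xi_word a b)]))"
    unfolding word_differential_def
    by (intro sum_eq_at) (auto intro!: sum.neutral simp: nth_xi_word simp del: replicate.simps)
  also have "\<dots> = - monomial [x_word (Suc (a + b))]"
    using replicate_add[of a "Suc b" x_letter] by (simp add: take_drop_xi_word nth_xi_word)
  finally show ?thesis .
qed

lemma cobracket_x_word [simp]: "cobracket (x_word k) = 0"
  unfolding cobracket_def by (intro sum.neutral ballI) (auto simp: Let_def)

text \<open>Only contractions of xi with an x survive. The first sum takes an x at position i in
  front of xi, the second an x with t letters between it and xi; the two resulting words are the
  arcs of the cyclic word between the contracted letters. Each sign exponent has a factor that is
  the degree of a block of x, hence is 0.\<close>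

lemma cobracket_xi_word:
  "cobracket (xi_word a b) = (\<Sum>i<a. monomial [x_word (a - Suc i), x_word (b + i)]) +
     (\<Sum>t<b. monomial [x_word t, x_word (b - Suc t + a)])"
proof -
  let ?w = "xi_word a b"
  define F where "F i j = (let p = take i ?w; u = drop (Suc i) (take j ?w); q = drop (Suc j) ?w in
        scale (sign (word_degree p * word_degree (drop i ?w)) *
               sign (letter_degree (?w ! j) * word_degree u) *
               inverse_pairing (?w ! i) (?w ! j))
          (monomial [u, q @ p]))" for i j
  have "cobracket ?w = (\<Sum>j<Suc (a + b). \<Sum>i<j. F i j)"
    unfolding cobracket_def F_def by simp
  also have "\<dots> = (\<Sum>i<a. F i a) + (\<Sum>t<b. F a (Suc (a + t)))"
    by (intro sum_triangle_hook) (auto simp: F_def Let_def nth_xi_word)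
  also have "(\<Sum>i<a. F i a) = (\<Sum>i<a. monomial [x_word (a - Suc i), x_word (b + i)])"
    by (intro sum.cong refl)
      (simp add: F_def Let_def nth_xi_word take_drop_xi_word replicate_add del: take_append drop_append)
  also have "(\<Sum>t<b. F a (Suc (a + t))) = (\<Sum>t<b. monomial [x_word t, x_word (b - Suc t + a)])"
  proof (intro sum.cong refl)
    fix t assume t: "t \<in> {..<b}"
    then have "drop (Suc a) (take (Suc (a + t)) ?w) = x_word t"
      by (simp add: drop_take min_def Suc_diff_le)
    moreover have "drop (Suc (Suc (a + t))) ?w = x_word (b - Suc t)"
      using take_drop_xi_word(2)[of a "Suc t" b] by simp
    ultimately show "F a (Suc (a + t)) = monomial [x_word t, x_word (b - Suc t + a)]"
      using t by (simp add: F_def Let_def nth_xi_word take_drop_xi_word replicate_add[symmetric]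
        del: take_append drop_append)
  qed
  finally show ?thesis .
qed

lemma bracket_x_word [simp]: "bracket (x_word k) (x_word l) = 0"
  unfolding bracket_def by (intro sum.neutral ballI) (auto simp: Let_def)

text \<open>Each of the k letters x can be contracted with xi, and all choices leave the same string
  of x, whence the multiplicity k. For k = 0 the sum over letters is empty.\<close>

lemma bracket_x_xi_word:
  "bracket (x_word k) (xi_word a b) = scale (of_nat k) (monomial [x_word (k - 1 + (a + b))])"
proof -
  let ?w = "xi_word a b"
  define F where "F i j = (let A = drop (Suc i) (x_word k) @ take i (x_word k);
        B = drop (Suc j) ?w @ take j ?w in
        scale (sign (word_degree (take (Suc i) (x_word k)) * word_degree (drop (Suc i) (x_word k))) *
               sign (word_degree (take j ?w) * word_degree (drop j ?w)) *
               sign (word_degree A) *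
               inverse_pairing (x_word k ! i) (?w ! j))
          (monomial [A @ B]))" for i j
  have "bracket (x_word k) ?w = (\<Sum>i<k. \<Sum>j<Suc (a + b). F i j)"
    unfolding bracket_def F_def by simp
  also have "\<dots> = (\<Sum>i<k. F i a)"
    by (intro sum.cong refl sum_eq_at) (auto simp: F_def Let_def nth_xi_word)
  also have "\<dots> = (\<Sum>i<k. monomial [x_word (k - 1 + (a + b))])"
  proof (intro sum.cong refl)
    fix i assume i: "i \<in> {..<k}"
    then have "k - Suc i + (i + (b + a)) = k - 1 + (a + b)" by simp
    then have "x_word (k - Suc i) @ x_word i @ x_word b @ x_word a = x_word (k - 1 + (a + b))"
      by (simp only: replicate_add[symmetric])
    then show "F i a = monomial [x_word (k - 1 + (a + b))]"
      using i by (simp add: F_def Let_def nth_xi_word take_drop_xi_word min_def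
        del: take_append drop_append)
  qed
  also have "\<dots> = scale (of_nat k) (monomial [x_word (k - 1 + (a + b))])"
    by (cases k) (simp_all add: tensor.sum_constant_scale)
  finally show ?thesis .
qed

lemma bracket_xi_x_word:
  "bracket (xi_word a b) (x_word k) = scale (of_nat k) (monomial [x_word (k - 1 + (a + b))])"
proof -
  let ?w = "xi_word a b"
  define F where "F j i = (let A = drop (Suc j) ?w @ take j ?w;
        B = drop (Suc i) (x_word k) @ take i (x_word k) in
        scale (sign (word_degree (take (Suc j) ?w) * word_degree (drop (Suc j) ?w)) *
               sign (word_degree (take i (x_word k)) * word_degree (drop i (x_word k))) *
               sign (word_degree A) *
               inverse_pairing (?w ! j) (x_word k ! i))
          (monomial [A @ B]))" for i j
  have "bracket ?w (x_word k) = (\<Sum>j<Suc (a + b). \<Sum>i<k. F j i)"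
    unfolding bracket_def F_def by simp
  also have "\<dots> = (\<Sum>i<k. F a i)"
    by (intro sum_eq_at) (auto simp: F_def Let_def nth_xi_word intro!: sum.neutral)
  also have "\<dots> = (\<Sum>i<k. monomial [x_word (k - 1 + (a + b))])"
  proof (intro sum.cong refl)
    fix i assume i: "i \<in> {..<k}"
    then have "b + (a + (k - Suc i + i)) = k - 1 + (a + b)" by simp
    then have "x_word b @ x_word a @ x_word (k - Suc i) @ x_word i = x_word (k - 1 + (a + b))"
      by (simp only: replicate_add[symmetric])
    then show "F a i = monomial [x_word (k - 1 + (a + b))]"
      using i by (simp add: F_def Let_def nth_xi_word take_drop_xi_word min_def
        del: take_append drop_append)
  qed
  also have "\<dots> = scale (of_nat k) (monomial [x_word (k - 1 + (a + b))])"
    by (cases k) (simp_all add: tensor.sum_constant_scale)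
  finally show ?thesis .
qed

lemma derivation_extension_xi:
  assumes "\<And>k. f (x_word k) = 0"
  shows "derivation_extension f (map x_word us @ xi_word a b # map x_word vs) =
    multiply_between (map x_word us) (f (xi_word a b)) (map x_word vs)"
proof -
  let ?ws = "map x_word us @ xi_word a b # map x_word vs"
  have "derivation_extension f ?ws =
    scale (sign (list_degree (take (length us) ?ws)))
        (multiply_between (take (length us) ?ws) (f (?ws ! length us)) (drop (Suc (length us)) ?ws))"
    unfolding derivation_extension_def
    by (intro sum_eq_at) (auto simp: nth_append nth_Cons' assms)
  then show ?thesis by (simp add: nth_append)
qed

definition remove_at :: "nat \<Rightarrow> 'a list \<Rightarrow> 'a list" where
  "remove_at i xs = take i xs @ drop (Suc i) xs"

lemma remove_at_append:
  "i < length xs \<Longrightarrow> remove_at i (xs @ ys) = remove_at i xs @ ys"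
  "remove_at (length xs + j) (xs @ ys) = xs @ remove_at j ys"
  by (simp_all add: remove_at_def)

lemma x_product_eq: "monomial (map x_word ks) = x_product ks"
  by (simp add: x_product_def)

text \<open>A bracket of two factors without xi is 0, so one of the two factors is always the one
  with xi. Factors to its left and to its right enter the bracket in opposite orders but with equal
  results, which permits a single sum over \<open>us @ vs\<close>. The merged word stands in front
  because \<open>delta\<close> puts it there.\<close>

lemma delta_xi:
  "delta (map x_word us @ xi_word a b # map x_word vs) =
     (\<Sum>i<length (us @ vs). scale (of_nat ((us @ vs) ! i))
        (x_product (((us @ vs) ! i - 1 + (a + b)) # remove_at i (us @ vs))))"
proof -
  let ?ws = "map x_word us @ xi_word a b # map x_word vs"
  define P where "P = length us"
  define F where "F i j = scale (sign (word_degree (?ws ! i) * list_degree (take i ?ws)) *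
               sign (word_degree (?ws ! j) *
                 (list_degree (take i ?ws) + list_degree (drop (Suc i) (take j ?ws)))))
          (multiply_between [] (bracket (?ws ! i) (?ws ! j))
             (take i ?ws @ drop (Suc i) (take j ?ws) @ drop (Suc j) ?ws))" for i j
  have "delta ?ws = (\<Sum>j<Suc (P + length vs). \<Sum>i<j. F i j)"
    unfolding delta_def F_def P_def by simp
  also have "\<dots> = (\<Sum>i<P. F i P) + (\<Sum>t<length vs. F P (Suc (P + t)))"
    by (intro sum_triangle_hook) (auto simp: F_def P_def nth_append nth_Cons')
  also have "(\<Sum>i<P. F i P) = (\<Sum>i<P. scale (of_nat ((us @ vs) ! i))
        (x_product (((us @ vs) ! i - 1 + (a + b)) # remove_at i (us @ vs))))"
  proof (intro sum.cong refl)
    fix i assume "i \<in> {..<P}"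
    then have i: "i < length us" by (simp add: P_def)
    have "take i ?ws = map x_word (take i us)" "drop (Suc i) (take P ?ws) = map x_word (drop (Suc i) us)"
      "drop (Suc P) ?ws = map x_word vs" "?ws ! i = x_word (us ! i)" "?ws ! P = xi_word a b"
      using i by (simp_all add: P_def take_map drop_map nth_append)
    then show "F i P = scale (of_nat ((us @ vs) ! i))
        (x_product (((us @ vs) ! i - 1 + (a + b)) # remove_at i (us @ vs)))"
      using i by (simp add: F_def bracket_x_xi_word multiply_between.scale nth_append
        remove_at_append x_product_eq[symmetric]) (simp add: remove_at_def)
  qed
  also have "(\<Sum>t<length vs. F P (Suc (P + t))) =
    (\<Sum>t<length vs. scale (of_nat ((us @ vs) ! (P + t)))
        (x_product (((us @ vs) ! (P + t) - 1 + (a + b)) # remove_at (P + t) (us @ vs))))"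
  proof (intro sum.cong refl)
    fix t assume t: "t \<in> {..<length vs}"
    then have "take P ?ws = map x_word us" "drop (Suc P) (take (Suc (P + t)) ?ws) = map x_word (take t vs)"
      "drop (Suc (Suc (P + t))) ?ws = map x_word (drop (Suc t) vs)"
      "?ws ! Suc (P + t) = x_word (vs ! t)" "?ws ! P = xi_word a b"
      by (simp_all add: P_def take_map drop_map nth_append)
    then show "F P (Suc (P + t)) = scale (of_nat ((us @ vs) ! (P + t)))
        (x_product (((us @ vs) ! (P + t) - 1 + (a + b)) # remove_at (P + t) (us @ vs)))"
      using t by (simp add: F_def bracket_xi_x_word multiply_between.scale nth_append P_def
        remove_at_append x_product_eq[symmetric]) (simp add: remove_at_def)
  qed
  finally show ?thesis
    by (simp add: P_def sum_lessThan_add)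
qed

text \<open>This is the loop equation at the level of tensors. It holds exactly, not only modulo
  \<open>relations\<close>, so it can be evaluated by any functional and also solved for its first
  term.\<close>

lemma total_differential_xi:
  "total_differential (monomial (map x_word us @ xi_word a b # map x_word vs)) =
     - x_product (us @ Suc (a + b) # vs) +
     (\<Sum>i<length (us @ vs). scale (of_nat ((us @ vs) ! i))
        (x_product (((us @ vs) ! i - 1 + (a + b)) # remove_at i (us @ vs)))) +
     ((\<Sum>i<a. x_product (us @ (a - Suc i) # (b + i) # vs)) +
      (\<Sum>t<b. x_product (us @ t # (b - Suc t + a) # vs)))"
  by (simp add: total_differential_monomial derivation_extension_xi delta_xi
      word_differential_xi_word cobracket_xi_word multiply_between.neg multiply_between.add
      multiply_between.sum x_product_eq[symmetric])

section \<open>Counting the letters xi along the differential\<close>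

definition xi_count :: "word list \<Rightarrow> nat" where
  "xi_count ws = (\<Sum>w\<leftarrow>ws. count_list w xi_letter)"

lemma xi_count_simps [simp]:
  "xi_count [] = 0"
  "xi_count (w # ws) = count_list w xi_letter + xi_count ws"
  "xi_count (vs @ ws) = xi_count vs + xi_count ws"
  by (simp_all add: xi_count_def)

lemma count_list_xi_eq_0D:
  assumes "count_list w xi_letter = 0"
  obtains k where "w = x_word k"
proof -
  have "c = x_letter" if "c \<in> set w" for c
    using assms that by (cases c) (auto simp: count_list_0_iff)
  then have "w = x_word (length w)" by (simp add: replicate_eqI)
  then show thesis by (rule that)
qed

lemma count_list_xi_eq_1D:
  assumes "count_list w xi_letter = 1"
  obtains a b where "w = xi_word a b"
proof -
  have "xi_letter \<in> set w" using assms by (metis count_list_0_iff zero_neq_one)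
  then obtain u v where w: "w = u @ xi_letter # v" by (meson split_list)
  then have "count_list u xi_letter = 0" "count_list v xi_letter = 0" using assms by auto
  then show thesis using w that by (elim count_list_xi_eq_0D) simp
qed

lemma xi_count_eq_0D:
  assumes "xi_count ws = 0"
  obtains ks where "ws = map x_word ks"
proof -
  have "\<exists>ks. ws = map x_word ks"
    using assms
  proof (induction ws)
    case (Cons w ws)
    then obtain ks k where "ws = map x_word ks" "w = x_word k"
      by (auto elim: count_list_xi_eq_0D)
    then have "w # ws = map x_word (k # ks)" by simp
    then show ?case by (rule exI)
  qed simp
  then show thesis using that by blast
qed

lemma xi_count_eq_1D:
  assumes "xi_count ws = 1"
  obtains us a b vs where "ws = map x_word us @ xi_word a b # map x_word vs"
proof -
  have "\<exists>us a b vs. ws = map x_word us @ xi_word a b # map x_word vs"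
    using assms
  proof (induction ws)
    case (Cons w ws)
    show ?case
    proof (cases "count_list w xi_letter = 0")
      case True
      then obtain k where "w = x_word k" by (rule count_list_xi_eq_0D)
      moreover obtain us a b vs where "ws = map x_word us @ xi_word a b # map x_word vs"
        using Cons True by auto
      ultimately have "w # ws = map x_word (k # us) @ xi_word a b # map x_word vs"
        by simp
      then show ?thesis by blast
    next
      case False
      with Cons.prems have "count_list w xi_letter = 1" "xi_count ws = 0" by auto
      then obtain a b vs where "w = xi_word a b" "ws = map x_word vs"
        by (elim count_list_xi_eq_1D xi_count_eq_0D)
      then have "w # ws = map x_word [] @ xi_word a b # map x_word vs" by simp
      then show ?thesis by blast
    qed
  qed simp
  then show thesis using that by blast
qed

lemma xi_count_x_words [simp]: "xi_count (map x_word ks) = 0"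
  by (induction ks) (simp_all add: count_list_0_iff)

lemma count_list_split:
  assumes "i < length w"
  shows "count_list w c =
    count_list (take i w) c + (if w ! i = c then 1 else 0) + count_list (drop (Suc i) w) c"
  by (subst id_take_nth_drop[OF assms]) simp

lemma xi_count_split:
  assumes "i < length ws"
  shows "xi_count ws =
    xi_count (take i ws) + count_list (ws ! i) xi_letter + xi_count (drop (Suc i) ws)"
  by (subst id_take_nth_drop[OF assms]) simp

lemma split_pair:
  assumes "i < j" "j < length xs"
  shows "xs = take i xs @ xs ! i # drop (Suc i) (take j xs) @ xs ! j # drop (Suc j) xs"
proof -
  have "take j xs = take i xs @ xs ! i # drop (Suc i) (take j xs)"
    using id_take_nth_drop[of i "take j xs"] assms by (simp add: min_def)
  then have "take j xs @ ys = take i xs @ xs ! i # drop (Suc i) (take j xs) @ ys" for ys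
    by (metis append.assoc append_Cons)
  then show ?thesis
    by (rule trans[OF id_take_nth_drop[OF assms(2)]])
qed

text \<open>Every part of the differential removes exactly one \<open>\<xi>\<close>.\<close>

definition xi_span :: "nat \<Rightarrow> tensor set" where
  "xi_span n = tensor.span {monomial vs | vs. Suc (xi_count vs) = n}"

lemma xi_span_closed:
  "0 \<in> xi_span n"
  "s \<in> xi_span n \<Longrightarrow> t \<in> xi_span n \<Longrightarrow> s + t \<in> xi_span n"
  "t \<in> xi_span n \<Longrightarrow> scale c t \<in> xi_span n"
  "(\<And>i. i \<in> A \<Longrightarrow> f i \<in> xi_span n) \<Longrightarrow> sum f A \<in> xi_span n"
  "Suc (xi_count vs) = n \<Longrightarrow> monomial vs \<in> xi_span n"
  unfolding xi_span_def
  by (auto intro: tensor.span_zero tensor.span_add tensor.span_scale tensor.span_sum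
      tensor.span_base)

text \<open>The differential is written with sums over all letters and all pairs of letters. This
  rule restricts the count of xi to those whose structure constant is nonzero.\<close>

lemma xi_span_scaleI:
  "(c \<noteq> 0 \<Longrightarrow> t \<in> xi_span n) \<Longrightarrow> scale c t \<in> xi_span n"
  by (cases "c = 0") (auto intro: xi_span_closed)

lemma multiply_between_xi_span:
  assumes "t \<in> xi_span n" "xi_count us + n + xi_count vs = m"
  shows "multiply_between us t vs \<in> xi_span m"
  using assms(1) unfolding xi_span_def[of n]
proof (induction rule: tensor.span_induct)
  case base
  show ?case
    by (auto simp: tensor.subspace_def multiply_between.add multiply_between.scale
        intro: xi_span_closed)
next
  case (step t)
  then show ?case using assms(2) by (auto intro!: xi_span_closed)
qed

text \<open>For a word without xi the target is \<open>xi_span 0\<close>, the span of the empty set,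
  so that case asserts that the differential vanishes.\<close>

lemma word_differential_xi_span: "word_differential w \<in> xi_span (count_list w xi_letter)"
  unfolding word_differential_def
proof (intro xi_span_closed(4) xi_span_scaleI xi_span_closed(5))
  fix i b
  assume i: "i \<in> {..<length w}"
    and "sign (word_degree (take i w)) * dual_differential (w ! i) b \<noteq> 0"
  then have "w ! i = xi_letter" "b = x_letter"
    by (cases "w ! i"; cases b; simp)+
  then show "Suc (xi_count [take i w @ [b] @ drop (Suc i) w]) = count_list w xi_letter"
    using i by (simp add: count_list_split[of i w])
qed

lemma inverse_pairing_count:
  "inverse_pairing a b \<noteq> 0 \<Longrightarrow>
    (if a = xi_letter then 1 else 0) + (if b = xi_letter then 1 else 0) = (1 :: nat)"
  by (cases a; cases b) simp_all

lemma cobracket_xi_span: "cobracket w \<in> xi_span (count_list w xi_letter)"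
  unfolding cobracket_def Let_def
proof (intro xi_span_closed(4) xi_span_scaleI xi_span_closed(5))
  fix i j
  let ?p = "take i w" and ?u = "drop (Suc i) (take j w)" and ?q = "drop (Suc j) w"
  assume ij: "j \<in> {..<length w}" "i \<in> {..<j}"
    and "sign (word_degree ?p * word_degree (drop i w)) *
      sign (letter_degree (w ! j) * word_degree ?u) * inverse_pairing (w ! i) (w ! j) \<noteq> 0"
  then have "(if w ! i = xi_letter then 1 else 0) + (if w ! j = xi_letter then 1 else 0) = (1 :: nat)"
    by (intro inverse_pairing_count) auto
  moreover have "count_list w xi_letter =
    count_list (?p @ w ! i # ?u @ w ! j # ?q) xi_letter"
    using split_pair[of i j w] ij by simp
  ultimately show "Suc (xi_count [?u, ?q @ ?p]) = count_list w xi_letter"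
    by (simp split: if_splits)
qed

lemma bracket_xi_span: "bracket v w \<in> xi_span (count_list v xi_letter + count_list w xi_letter)"
  unfolding bracket_def Let_def
proof (intro xi_span_closed(4) xi_span_scaleI xi_span_closed(5))
  fix i j
  let ?A = "drop (Suc i) v @ take i v" and ?B = "drop (Suc j) w @ take j w"
  assume ij: "i \<in> {..<length v}" "j \<in> {..<length w}"
    and "sign (word_degree (take (Suc i) v) * word_degree (drop (Suc i) v)) *
      sign (word_degree (take j w) * word_degree (drop j w)) * sign (word_degree ?A) *
      inverse_pairing (v ! i) (w ! j) \<noteq> 0"
  then have "(if v ! i = xi_letter then 1 else 0) + (if w ! j = xi_letter then 1 else 0) = (1 :: nat)"
    by (intro inverse_pairing_count) auto
  then show "Suc (xi_count [?A @ ?B]) = count_list v xi_letter + count_list w xi_letter"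
    using ij by (simp add: count_list_split[of i v] count_list_split[of j w] split: if_splits)
qed

lemma derivation_extension_xi_span:
  assumes "\<And>w. f w \<in> xi_span (count_list w xi_letter)"
  shows "derivation_extension f ws \<in> xi_span (xi_count ws)"
  unfolding derivation_extension_def
  by (intro xi_span_closed(3,4) multiply_between_xi_span[OF assms])
    (simp add: xi_count_split[symmetric])

lemma delta_xi_span: "delta ws \<in> xi_span (xi_count ws)"
  unfolding delta_def
proof (intro xi_span_closed(3,4) multiply_between_xi_span[OF bracket_xi_span])
  fix i j assume "j \<in> {..<length ws}" "i \<in> {..<j}"
  then have "xi_count ws =
    xi_count (take i ws @ ws ! i # drop (Suc i) (take j ws) @ ws ! j # drop (Suc j) ws)"
    using split_pair[of i j ws] by simp
  then show "xi_count [] + (count_list (ws ! i) xi_letter + count_list (ws ! j) xi_letter) +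
      xi_count (take i ws @ drop (Suc i) (take j ws) @ drop (Suc j) ws) = xi_count ws"
    by simp
qed

lemma total_differential_xi_span: "total_differential (monomial ws) \<in> xi_span (xi_count ws)"
  unfolding total_differential_monomial
  by (intro xi_span_closed(2) derivation_extension_xi_span word_differential_xi_span
      cobracket_xi_span delta_xi_span)

section \<open>Loop equations and cohomology classes\<close>

definition evaluation :: "(word list \<Rightarrow> complex) \<Rightarrow> tensor \<Rightarrow> complex" where
  "evaluation E t = (\<Sum>ws\<in>Poly_Mapping.keys t. Poly_Mapping.lookup t ws * E ws)"

lemma evaluation_superset:
  assumes "finite K" "Poly_Mapping.keys t \<subseteq> K"
  shows "evaluation E t = (\<Sum>ws\<in>K. Poly_Mapping.lookup t ws * E ws)"
  unfolding evaluation_def using assms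
  by (intro sum.mono_neutral_left) (auto simp: in_keys_iff)

interpretation evaluation: Vector_Spaces.linear scale "(*)" "evaluation E" for E
proof (intro Vector_Spaces.linear_iff[THEN iffD2] conjI allI)
  show "vector_space ((*) :: complex \<Rightarrow> complex \<Rightarrow> complex)"
    by unfold_locales (simp_all add: algebra_simps)
  fix s t :: tensor and c :: complex
  let ?K = "Poly_Mapping.keys s \<union> Poly_Mapping.keys t \<union> Poly_Mapping.keys (s + t) \<union>
    Poly_Mapping.keys (scale c s)"
  have K: "evaluation E u = (\<Sum>ws\<in>?K. Poly_Mapping.lookup u ws * E ws)"
    if "u \<in> {s, t, s + t, scale c s}" for u
    using that by (intro evaluation_superset) auto
  show "evaluation E (s + t) = evaluation E s + evaluation E t"
    by (simp add: K lookup_add distrib_right sum.distrib)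
  show "evaluation E (scale c s) = c * evaluation E s"
    by (simp add: K sum_distrib_left mult.assoc)
qed (rule tensor.vector_space_axioms)

lemma evaluation_monomial [simp]: "evaluation E (monomial ws) = E ws"
  by (simp add: evaluation_def lookup_monomial)

lemma tensor_as_sum:
  "t = (\<Sum>ws\<in>Poly_Mapping.keys t. scale (Poly_Mapping.lookup t ws) (monomial ws))"
proof (intro poly_mapping_eqI)
  fix vs
  have "(\<Sum>ws\<in>Poly_Mapping.keys t. Poly_Mapping.lookup t ws * (if vs = ws then 1 else 0)) =
    Poly_Mapping.lookup t vs"
  proof (cases "vs \<in> Poly_Mapping.keys t")
    case True
    then show ?thesis by (subst sum_eq_at[of _ vs]) auto
  next
    case False
    then show ?thesis by (subst sum.neutral) (auto simp: in_keys_iff)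
  qed
  then show "Poly_Mapping.lookup t vs = Poly_Mapping.lookup
    (\<Sum>ws\<in>Poly_Mapping.keys t. scale (Poly_Mapping.lookup t ws) (monomial ws)) vs"
    by (simp only: lookup_sum lookup_scale lookup_monomial)
qed

text \<open>These are the two properties of the moments that make the functional descend to
  cohomology: symmetry serves the transposition of factors, the loop equation serves the
  differential. Expanding the first trace is enough, as symmetry moves any factor to the
  front.\<close>

locale schwinger_dyson =
  fixes M :: "nat list \<Rightarrow> complex"
  assumes symmetric: "mset ks = mset ls \<Longrightarrow> M ks = M ls"
    and loop_equation: "M (Suc m # ks) = (\<Sum>r<m. M (r # (m - Suc r) # ks)) +
      (\<Sum>i<length ks. of_nat (ks ! i) * M ((ks ! i - 1 + m) # remove_at i ks))"
begin

text \<open>A word without xi is determined by its length, so the list of lengths recovers the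
  exponents of the product.\<close>

definition value_of :: "tensor \<Rightarrow> complex" where
  "value_of = evaluation (\<lambda>ws. if xi_count ws = 0 then M (map length ws) else 0)"

sublocale value_of: Vector_Spaces.linear scale "(*)" value_of
  unfolding value_of_def by (rule evaluation.linear_axioms)

lemma value_of_monomial:
  "value_of (monomial ws) = (if xi_count ws = 0 then M (map length ws) else 0)"
  by (simp add: value_of_def)

lemma value_of_x_product [simp]: "value_of (x_product ks) = M ks"
  by (simp add: x_product_eq[symmetric] value_of_monomial comp_def)

lemma value_of_xi_span:
  assumes "t \<in> xi_span n" "n \<noteq> 1"
  shows "value_of t = 0"
  using assms(1) unfolding xi_span_def
proof (induction rule: tensor.span_induct)
  case base
  show ?case
    by (auto simp: tensor.subspace_def value_of.add value_of.scale)
next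
  case (step t)
  then show ?case using assms(2) by (auto simp: value_of_monomial split: if_splits)
qed

text \<open>The cobracket distinguishes the x before xi from those after it. The first sum is the
  part r = a - 1 - i of the loop equation, the second the part r = a + (b - 1 - t) with its two
  traces exchanged; together they exhaust all r < a + b.\<close>

lemma loop_equation_between:
  "M (us @ Suc (a + b) # vs) =
     (\<Sum>i<length (us @ vs). of_nat ((us @ vs) ! i) *
        M (((us @ vs) ! i - 1 + (a + b)) # remove_at i (us @ vs))) +
     ((\<Sum>i<a. M (us @ (a - Suc i) # (b + i) # vs)) +
      (\<Sum>t<b. M (us @ t # (b - Suc t + a) # vs)))"
proof -
  define g where "g r = M (r # (a + b - Suc r) # us @ vs)" for r
  have "(\<Sum>i<a. M (us @ (a - Suc i) # (b + i) # vs)) = (\<Sum>i<a. g (a - Suc i))"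
    unfolding g_def by (intro sum.cong refl symmetric) (auto simp: add.commute)
  moreover have "(\<Sum>t<b. M (us @ t # (b - Suc t + a) # vs)) = (\<Sum>t<b. g (a + (b - Suc t)))"
    unfolding g_def by (intro sum.cong refl symmetric) (auto simp: add.commute)
  moreover have "M (us @ Suc (a + b) # vs) = M (Suc (a + b) # us @ vs)"
    by (intro symmetric) simp
  moreover have "(\<Sum>r<a + b. g r) = (\<Sum>i<a. g (a - Suc i)) + (\<Sum>t<b. g (a + (b - Suc t)))"
    using sum.nat_diff_reindex[of g a] sum.nat_diff_reindex[of "\<lambda>t. g (a + t)" b]
    by (simp add: sum_lessThan_add)
  ultimately show ?thesis
    by (simp add: loop_equation g_def)
qed

lemma value_of_total_differential_monomial: "value_of (total_differential (monomial ws)) = 0"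
proof (cases "xi_count ws = 1")
  case True
  then obtain us a b vs where "ws = map x_word us @ xi_word a b # map x_word vs"
    by (rule xi_count_eq_1D)
  then show ?thesis
    by (simp only: total_differential_xi value_of.add value_of.neg value_of.sum value_of.scale
        value_of_x_product) (simp add: loop_equation_between)
\<comment> \<open>Without xi the differential is 0, and with two or more each of its terms still
  contains a xi; in both cases the functional sees nothing.\<close>
next
  case False
  then show ?thesis
    using value_of_xi_span[OF total_differential_xi_span] by blast
qed

lemma value_of_total_differential: "value_of (total_differential t) = 0"
proof -
  have "value_of (total_differential (\<Sum>ws\<in>K. scale (c ws) (monomial ws))) = 0" for K c
    by (simp add: total_differential.sum total_differential.scale value_of.sum value_of.scale
        value_of_total_differential_monomial)
  from this[of "Poly_Mapping.lookup t" "Poly_Mapping.keys t"] show ?thesis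
    by (simp only: tensor_as_sum[of t, symmetric])
qed

text \<open>Both kinds of relation preserve the number of xi. If there is a xi, both terms have
  value 0; if there is none, the Koszul sign is 1, rotation keeps all lengths and transposition
  permutes them.\<close>

lemma value_of_relations: "t \<in> relations \<Longrightarrow> value_of t = 0"
  unfolding relations_def
proof (induction rule: tensor.span_induct)
  case base
  show ?case
    by (auto simp: tensor.subspace_def value_of.add value_of.scale)
next
  case (step t)
  then consider
    us a w vs where "t = monomial (us @ [a # w] @ vs) -
      scale (sign (letter_degree a * word_degree w)) (monomial (us @ [w @ [a]] @ vs))"
    | us v w vs where "t = monomial (us @ [v, w] @ vs) -
      scale (sign (word_degree v * word_degree w)) (monomial (us @ [w, v] @ vs))"
    by blast
  then show ?case
  proof cases
    case 1
    have "sign (letter_degree a * word_degree w) = 1" if "count_list w xi_letter = 0"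
      using that by (auto elim: count_list_xi_eq_0D)
    then show ?thesis
      by (auto simp: 1 value_of.diff value_of.scale value_of_monomial)
  next
    case 2
    have "sign (word_degree v * word_degree w) = 1" if "count_list w xi_letter = 0"
      using that by (auto elim: count_list_xi_eq_0D)
    moreover have "M (map length us @ length w # length v # map length vs) =
      M (map length us @ length v # length w # map length vs)"
      by (intro symmetric) simp
    ultimately show ?thesis
      by (auto simp: 2 value_of.diff value_of.scale value_of_monomial)
  qed
qed

lemma value_of_cohomologous: "cohomologous s t \<Longrightarrow> value_of s = value_of t"
  unfolding cohomologous_def
  by (auto dest!: value_of_relations simp: value_of.diff value_of_total_differential)

lemma value_of_nu_polynomial:
  "value_of (nu_polynomial p) = (\<Sum>k\<le>degree p. coeff p k * M (replicate k 0))"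
  by (simp add: nu_polynomial_def value_of.sum value_of.scale value_of_monomial)
    (simp add: xi_count_def sum_list_replicate)

end

section \<open>Existence and uniqueness of the representing polynomial\<close>

lemma nu_polynomial_superset:
  assumes "degree p \<le> n"
  shows "nu_polynomial p = (\<Sum>k\<le>n. scale (coeff p k) (monomial (replicate k [])))"
  unfolding nu_polynomial_def
  by (intro sum.mono_neutral_left) (use assms in \<open>auto simp: coeff_eq_0\<close>)

lemma nu_polynomial_add: "nu_polynomial (p + q) = nu_polynomial p + nu_polynomial q"
  using nu_polynomial_superset[of _ "max (degree p) (degree q)"]
  by (simp add: degree_add_le tensor.scale_left_distrib sum.distrib)

lemma nu_polynomial_smult: "nu_polynomial (Polynomial.smult c p) = scale c (nu_polynomial p)"
  using nu_polynomial_superset[of _ "degree p"]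
  by (simp add: degree_smult_le tensor.scale_sum_right)

lemma nu_polynomial_monom: "nu_polynomial (monom 1 k) = monomial (replicate k [])"
proof -
  have "nu_polynomial (monom 1 k) = scale (coeff (monom 1 k) k) (monomial (replicate k []))"
    unfolding nu_polynomial_def by (subst degree_monom_eq, simp, intro sum_eq_at) auto
  then show ?thesis by simp
qed

text \<open>Polynomials and primitives of the summands can simply be added and scaled. This lets the
  existence proof treat the terms of a solved loop equation one by one.\<close>

lemma subspace_cohomologous_nu: "tensor.subspace {t. \<exists>p. cohomologous (nu_polynomial p) t}"
  unfolding tensor.subspace_def
proof (intro conjI ballI allI)
  have "cohomologous (nu_polynomial 0) 0"
    unfolding cohomologous_def relations_def
    by (rule exI[of _ 0]) (simp add: nu_polynomial_def total_differential.zero tensor.span_zero)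
  then show "0 \<in> {t. \<exists>p. cohomologous (nu_polynomial p) t}" by blast
next
  fix s t assume "s \<in> {t. \<exists>p. cohomologous (nu_polynomial p) t}"
    and "t \<in> {t. \<exists>p. cohomologous (nu_polynomial p) t}"
  then obtain p q y z where "nu_polynomial p - s - total_differential y \<in> relations"
    "nu_polynomial q - t - total_differential z \<in> relations"
    by (auto simp: cohomologous_def)
  then have "(nu_polynomial p - s - total_differential y) +
    (nu_polynomial q - t - total_differential z) \<in> relations"
    unfolding relations_def by (rule tensor.span_add)
  then have "nu_polynomial (p + q) - (s + t) - total_differential (y + z) \<in> relations"
    by (simp add: nu_polynomial_add total_differential.add algebra_simps)
  then show "s + t \<in> {t. \<exists>p. cohomologous (nu_polynomial p) t}"
    by (auto simp: cohomologous_def)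
next
  fix c t assume "t \<in> {t. \<exists>p. cohomologous (nu_polynomial p) t}"
  then obtain p y where "nu_polynomial p - t - total_differential y \<in> relations"
    by (auto simp: cohomologous_def)
  then have "scale c (nu_polynomial p - t - total_differential y) \<in> relations"
    unfolding relations_def by (rule tensor.span_scale)
  then have "nu_polynomial (Polynomial.smult c p) - scale c t - total_differential (scale c y) \<in> relations"
    by (simp add: nu_polynomial_smult total_differential.scale tensor.scale_right_diff_distrib)
  then show "scale c t \<in> {t. \<exists>p. cohomologous (nu_polynomial p) t}"
    by (auto simp: cohomologous_def)
qed

lemma sum_list_remove_at:
  "i < length xs \<Longrightarrow> sum_list (remove_at i xs) + xs ! i = sum_list (xs :: nat list)"
  using arg_cong[OF id_take_nth_drop, of i xs sum_list] by (simp add: remove_at_def)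

lemma ex_cohomologous_nu_polynomial: "\<exists>p. cohomologous (nu_polynomial p) (x_product ks)"
proof (induction "sum_list ks" arbitrary: ks rule: less_induct)
  case less
  let ?C = "{t. \<exists>p. cohomologous (nu_polynomial p) t}"
  have IH: "x_product ls \<in> ?C" if "sum_list ls < sum_list ks" for ls
    using less that by blast
  show ?case
  proof (cases "\<forall>k\<in>set ks. k = 0")
    case True
    then obtain n where ks: "ks = replicate n 0" by (metis replicate_length_same)
    \<comment> \<open>Since x^0 is the empty word, the two tensors are equal and the primitive 0
      suffices.\<close>
    have "cohomologous (nu_polynomial (monom 1 n)) (x_product ks)"
      unfolding cohomologous_def relations_def ks
      by (rule exI[of _ 0])
        (simp add: nu_polynomial_monom x_product_def total_differential.zero tensor.span_zero)
    then show ?thesis by blast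
  next
    case False
    then obtain k where k: "k \<in> set ks" "k \<noteq> 0" by blast
    then obtain us vs where "ks = us @ k # vs" by (meson split_list)
    with k obtain m where ks: "ks = us @ Suc m # vs" by (metis not0_implies_Suc)
    \<comment> \<open>One x of the factor x^(m+1) is replaced by xi. With xi in front, the cobracket
      contributes only its second sum.\<close>
    define y where "y = monomial (map x_word us @ xi_word 0 m # map x_word vs)"
    define R where "R = (\<Sum>i<length (us @ vs). scale (of_nat ((us @ vs) ! i))
        (x_product (((us @ vs) ! i - 1 + m) # remove_at i (us @ vs)))) +
      (\<Sum>t<m. x_product (us @ t # (m - Suc t) # vs))"
    have Dy: "total_differential y = R - x_product ks"
      using total_differential_xi[of us 0 m vs] by (simp add: y_def R_def ks)
    \<comment> \<open>The total drops by 2 in general, and still by 1 when the i-th exponent is 0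
      and the subtraction is truncated, so no case distinction is needed.\<close>
    have "sum_list (((us @ vs) ! i - 1 + m) # remove_at i (us @ vs)) < sum_list ks"
      if "i < length (us @ vs)" for i
      using sum_list_remove_at[OF that] by (simp add: ks)
    then have "R \<in> ?C"
      unfolding R_def
      by (intro tensor.subspace_add tensor.subspace_sum tensor.subspace_scale
          subspace_cohomologous_nu IH) (auto simp: ks)
    then obtain p z where "nu_polynomial p - R - total_differential z \<in> relations"
      by (auto simp: cohomologous_def)
    then have "nu_polynomial p - x_product ks - total_differential (z + y) \<in> relations"
      by (simp add: total_differential.add Dy algebra_simps)
    then show ?thesis by (auto simp: cohomologous_def)
  qed
qed

text \<open>The conclusion concerns one N, but a whole family of functionals enters: two
  representing polynomials have the same value at each positive integer, and only infinitely many
  such points force them to coincide.\<close>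

lemma class_polynomial_eqI:
  fixes M :: "nat \<Rightarrow> nat list \<Rightarrow> complex"
  assumes SD: "\<And>N. N \<ge> 1 \<Longrightarrow> schwinger_dyson (M N)"
    and nu: "\<And>N k. N \<ge> 1 \<Longrightarrow> M N (replicate k 0) = of_nat N ^ k"
    and N: "N \<ge> 1"
  shows "poly (class_polynomial ks) (of_nat N) = M N ks"
proof -
  have eval_nu: "poly p (of_nat n) = M n ks"
    if "cohomologous (nu_polynomial p) (x_product ks)" "n \<ge> 1" for p n
  proof -
    interpret schwinger_dyson "M n" by (rule SD) fact
    show ?thesis
      using value_of_cohomologous[OF that(1)]
      by (simp add: value_of_nu_polynomial nu[OF that(2)] poly_altdef)
  qed
  have unique: "p = q" if "cohomologous (nu_polynomial p) (x_product ks)"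
    "cohomologous (nu_polynomial q) (x_product ks)" for p q
  proof -
    have "(of_nat :: nat \<Rightarrow> complex) ` {1..} \<subseteq> {x. poly (p - q) x = 0}"
      using eval_nu[OF that(1)] eval_nu[OF that(2)] by auto
    moreover have "infinite ((of_nat :: nat \<Rightarrow> complex) ` {1..})"
      by (subst finite_image_iff) (simp_all add: inj_on_def infinite_Ici)
    ultimately have "infinite {x. poly (p - q) x = 0}"
      by (rule infinite_super)
    then have "p - q = 0" using poly_roots_finite[of "p - q"] by blast
    then show ?thesis by simp
  qed
  have "\<exists>!p. cohomologous (nu_polynomial p) (x_product ks)"
    by (intro ex_ex1I ex_cohomologous_nu_polynomial unique)
  then have "cohomologous (nu_polynomial (class_polynomial ks)) (x_product ks)"
    unfolding class_polynomial_def by (rule theI')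
  then show ?thesis using N by (rule eval_nu)
qed

section \<open>Gaussian integration by parts\<close>

text \<open>One-variable integration by parts for powers, read off from the closed formulas for
  Gaussian moments instead of from boundary terms. For even n both sides are 0.\<close>

lemma normal_moment_Suc:
  assumes "s > 0"
  shows "(\<integral>x. normal_density 0 s x * x ^ Suc n \<partial>lborel) =
    real n * s\<^sup>2 * (\<integral>x. normal_density 0 s x * x ^ (n - 1) \<partial>lborel)"
proof (cases "even n")
  case True
  then obtain k where n: "n = 2 * k" by (rule evenE)
  \<comment> \<open>For n = 0 the right-hand side has the factor 0; otherwise n - 1 is odd and its
    moment vanishes.\<close>
  then have "n = 0 \<or> n - 1 = 2 * (k - 1) + 1" by (cases k) auto
  then show ?thesis
    using integral_normal_moment_odd[OF assms, of 0 k] integral_normal_moment_odd[OF assms, of 0 "k - 1"]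
    by (auto simp: n)
next
  case False
  then obtain k where n: "n = 2 * k + 1" by (rule oddE)
  have "(\<integral>x. normal_density 0 s x * x ^ Suc n \<partial>lborel) =
    fact (2 * Suc k) / ((2 / s\<^sup>2) ^ Suc k * fact (Suc k))"
    using integral_normal_moment_even[OF assms, of 0 "Suc k"] by (simp add: n)
  also have "\<dots> = real n * s\<^sup>2 * (fact (2 * k) / ((2 / s\<^sup>2) ^ k * fact k))"
  proof -
    have facts: "fact (2 * Suc k) = 2 * (real k + 1) * real n * fact (2 * k)"
      "fact (Suc k) = (real k + 1) * fact k"
      by (simp_all add: n algebra_simps)
    \<comment> \<open>The cancellation treats factorials and powers as opaque: a is k + 1, b is n, t
      is the variance, F and Q are the factorials of 2k and k, and P is the k-th power.\<close>
    have "2 * a * b * F / (2 / t * P * (a * Q)) = b * t * (F / (P * Q))"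
      if "a \<noteq> 0" "t \<noteq> 0" for a b F P Q t :: real
      using that by (simp add: divide_simps)
    then show ?thesis
      unfolding facts power_Suc by this (use assms in auto)
  qed
  also have "fact (2 * k) / ((2 / s\<^sup>2) ^ k * fact k) =
    (\<integral>x. normal_density 0 s x * x ^ (n - 1) \<partial>lborel)"
    using integral_normal_moment_even[OF assms, of 0 k] by (simp add: n)
  finally show ?thesis .
qed

section \<open>Polynomial functions and their partial derivatives\<close>

definition coordinate_monomial :: "'i set \<Rightarrow> ('i \<Rightarrow> nat) \<Rightarrow> ('i \<Rightarrow> real) \<Rightarrow> complex" where
  "coordinate_monomial I n m = of_real (\<Prod>p\<in>I. m p ^ n p)"

text \<open>Built by adding one scaled monomial at a time, so that induction reduces linear
  statements, such as integrability or integration by parts, to a single monomial. Closure under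
  products is then a theorem.\<close>

inductive polynomial_fun :: "'i set \<Rightarrow> (('i \<Rightarrow> real) \<Rightarrow> complex) \<Rightarrow> bool" for I where
  zero: "polynomial_fun I (\<lambda>m. 0)"
| step: "polynomial_fun I f \<Longrightarrow> polynomial_fun I (\<lambda>m. c * coordinate_monomial I n m + f m)"

lemma polynomial_fun_monomial: "polynomial_fun I (\<lambda>m. c * coordinate_monomial I n m)"
  using polynomial_fun.step[OF polynomial_fun.zero, of I c n] by simp

lemma polynomial_fun_const: "polynomial_fun I (\<lambda>m. c)"
  using polynomial_fun_monomial[of I c "\<lambda>_. 0"] by (simp add: coordinate_monomial_def)

lemma polynomial_fun_coordinate:
  assumes "finite I" "p \<in> I"
  shows "polynomial_fun I (\<lambda>m. of_real (m p))"
proof -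
  have "(\<Prod>q\<in>I. m q ^ (if q = p then 1 else 0)) = m p" for m :: "'a \<Rightarrow> real"
    using assms by (subst prod.remove[of _ p]) (auto intro!: prod.neutral)
  then show ?thesis
    using polynomial_fun_monomial[of I 1 "\<lambda>q. if q = p then 1 else 0"]
    by (simp add: coordinate_monomial_def)
qed

lemma polynomial_fun_add:
  "polynomial_fun I f \<Longrightarrow> polynomial_fun I g \<Longrightarrow> polynomial_fun I (\<lambda>m. f m + g m)"
proof (induction rule: polynomial_fun.induct)
  case (step f c n)
  then show ?case
    using polynomial_fun.step[of I "\<lambda>m. f m + g m" c n] by (simp add: add.assoc)
qed simp

lemma coordinate_monomial_mult:
  "coordinate_monomial I n m * coordinate_monomial I n' m = coordinate_monomial I (\<lambda>p. n p + n' p) m"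
  by (simp add: coordinate_monomial_def power_add prod.distrib)

lemma polynomial_fun_mult:
  assumes "polynomial_fun I f" "polynomial_fun I g"
  shows "polynomial_fun I (\<lambda>m. f m * g m)"
proof -
  have mono: "polynomial_fun I (\<lambda>m. c * coordinate_monomial I n m * g m)" for c n
    using assms(2)
  proof (induction rule: polynomial_fun.induct)
    case (step g d n')
    then show ?case
      using polynomial_fun.step[of I "\<lambda>m. c * coordinate_monomial I n m * g m" "c * d"
          "\<lambda>p. n p + n' p"]
      by (simp add: coordinate_monomial_mult[symmetric] algebra_simps)
  qed (simp add: polynomial_fun.zero)
  show ?thesis
    using assms(1)
  proof (induction rule: polynomial_fun.induct)
    case (step f c n)
    then show ?case
      using polynomial_fun_add[OF mono] by (simp add: distrib_right)
  qed (simp add: polynomial_fun.zero)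
qed

lemma polynomial_fun_sum:
  "(\<And>i. i \<in> A \<Longrightarrow> polynomial_fun I (f i)) \<Longrightarrow> polynomial_fun I (\<lambda>m. \<Sum>i\<in>A. f i m)"
  by (induction A rule: infinite_finite_induct)
    (auto intro: polynomial_fun_add polynomial_fun.zero)

text \<open>A relation rather than an operator: the rules of calculus produce a derivative of the
  required shape, and uniqueness identifies it with the one found by integration by parts.\<close>

definition has_partial ::
  "'i \<Rightarrow> (('i \<Rightarrow> real) \<Rightarrow> complex) \<Rightarrow> (('i \<Rightarrow> real) \<Rightarrow> complex) \<Rightarrow> bool" where
  "has_partial p f g \<longleftrightarrow>
    (\<forall>m. ((\<lambda>t. f (m(p := t))) has_vector_derivative g m) (at (m p)))"

lemma has_partial_unique: "has_partial p f g \<Longrightarrow> has_partial p f h \<Longrightarrow> g = h"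
  unfolding has_partial_def fun_eq_iff by (blast intro: vector_derivative_unique_at)

lemma has_partial_const: "has_partial p (\<lambda>m. c) (\<lambda>m. 0)"
  by (simp add: has_partial_def)

lemma has_partial_add:
  "has_partial p f f' \<Longrightarrow> has_partial p g g' \<Longrightarrow> has_partial p (\<lambda>m. f m + g m) (\<lambda>m. f' m + g' m)"
  by (auto simp: has_partial_def intro: has_vector_derivative_add)

lemma has_partial_mult:
  assumes "has_partial p f f'" "has_partial p g g'"
  shows "has_partial p (\<lambda>m. f m * g m) (\<lambda>m. f m * g' m + f' m * g m)"
  unfolding has_partial_def
proof
  fix m
  show "((\<lambda>t. f (m(p := t)) * g (m(p := t))) has_vector_derivative f m * g' m + f' m * g m)
    (at (m p))"
    using has_vector_derivative_mult[of "\<lambda>t. f (m(p := t))" "f' m" "m p" UNIV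
        "\<lambda>t. g (m(p := t))" "g' m"] assms
    by (simp add: has_partial_def)
qed

lemma has_partial_coordinate:
  "has_partial p (\<lambda>m. of_real (m q)) (\<lambda>m. if p = q then 1 else 0)"
proof (cases "p = q")
  case True
  then show ?thesis
    using has_vector_derivative_of_real[OF DERIV_ident]
    by (auto simp: has_partial_def)
qed (simp add: has_partial_def)

lemma has_partial_monomial:
  assumes "finite I" "p \<in> I"
  shows "has_partial p (coordinate_monomial I n)
    (\<lambda>m. of_nat (n p) * coordinate_monomial I (n(p := n p - 1)) m)"
  unfolding has_partial_def
proof
  fix m :: "'a \<Rightarrow> real"
  define R where "R = (\<Prod>q\<in>I - {p}. m q ^ n q)"
  have "((\<lambda>t. t ^ n p * R) has_real_derivative (of_nat (n p) * m p ^ (n p - 1) * R)) (at (m p))"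
    by (auto intro!: derivative_eq_intros)
  then have "((\<lambda>t. complex_of_real (t ^ n p * R)) has_vector_derivative
    of_real (of_nat (n p) * m p ^ (n p - 1) * R)) (at (m p))"
    by (rule has_vector_derivative_of_real)
  moreover have "coordinate_monomial I n (m(p := t)) = complex_of_real (t ^ n p * R)" for t
    using assms by (simp add: coordinate_monomial_def R_def prod.remove[of I p])
  moreover have "coordinate_monomial I (n(p := n p - 1)) m = complex_of_real (m p ^ (n p - 1) * R)"
    using assms by (simp add: coordinate_monomial_def R_def prod.remove[of I p])
  ultimately show "((\<lambda>t. coordinate_monomial I n (m(p := t))) has_vector_derivative
    of_nat (n p) * coordinate_monomial I (n(p := n p - 1)) m) (at (m p))"
    by (simp add: mult.assoc)
qed

section \<open>Integration by parts for independent Gaussian coordinates\<close>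

locale gaussian_family =
  fixes I :: "'i set" and s :: "'i \<Rightarrow> real"
  assumes finite_index: "finite I" and scale_pos: "\<And>p. s p > 0"
begin

definition density :: "('i \<Rightarrow> real) \<Rightarrow> complex" where
  "density m = of_real (\<Prod>p\<in>I. normal_density 0 (s p) (m p))"

definition mean :: "(('i \<Rightarrow> real) \<Rightarrow> complex) \<Rightarrow> complex" where
  "mean f = (\<integral>m. f m * density m \<partial>Pi\<^sub>M I (\<lambda>_. lborel))"

definition moment :: "'i \<Rightarrow> nat \<Rightarrow> real" where
  "moment p n = (\<integral>x. normal_density 0 (s p) x * x ^ n \<partial>lborel)"

lemma monomial_density:
  "coordinate_monomial I n m * density m =
    of_real (\<Prod>p\<in>I. normal_density 0 (s p) (m p) * m p ^ n p)"
  by (simp add: coordinate_monomial_def density_def prod.distrib mult.commute)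

text \<open>Together with the density a monomial is a product of functions of one coordinate each,
  so integrability and value come from Fubini for finite products.\<close>

lemma
  shows integrable_monomial:
      "integrable (Pi\<^sub>M I (\<lambda>_. lborel)) (\<lambda>m. coordinate_monomial I n m * density m)"
    and mean_monomial: "mean (coordinate_monomial I n) = of_real (\<Prod>p\<in>I. moment p (n p))"
proof -
  interpret product_sigma_finite "\<lambda>_ :: 'i. lborel :: real measure" by standard
  have int: "integrable lborel (\<lambda>x. normal_density 0 (s p) x * x ^ n p)" for p
    using integrable_normal_moment[OF scale_pos[of p], of 0 "n p"] by simp
  show "integrable (Pi\<^sub>M I (\<lambda>_. lborel)) (\<lambda>m. coordinate_monomial I n m * density m)"
    unfolding monomial_density
    by (intro integrable_of_real product_integrable_prod finite_index int)
  show "mean (coordinate_monomial I n) = of_real (\<Prod>p\<in>I. moment p (n p))"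
    unfolding mean_def monomial_density moment_def
    by (subst integral_complex_of_real, subst product_integral_prod)
      (simp_all add: finite_index int)
qed

lemma integrable_polynomial:
  assumes "polynomial_fun I f"
  shows "integrable (Pi\<^sub>M I (\<lambda>_. lborel)) (\<lambda>m. f m * density m)"
  using assms
proof (induction rule: polynomial_fun.induct)
  case (step f c n)
  have "integrable (Pi\<^sub>M I (\<lambda>_. lborel))
    (\<lambda>m. c * (coordinate_monomial I n m * density m) + f m * density m)"
    by (intro Bochner_Integration.integrable_add integrable_mult_right integrable_monomial step)
  then show ?case by (simp add: algebra_simps)
qed simp

lemma mean_add:
  "polynomial_fun I f \<Longrightarrow> polynomial_fun I g \<Longrightarrow> mean (\<lambda>m. f m + g m) = mean f + mean g"
  unfolding mean_def distrib_right
  by (intro Bochner_Integration.integral_add integrable_polynomial)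

lemma mean_scale: "mean (\<lambda>m. c * f m) = c * mean f"
  unfolding mean_def mult.assoc by (rule integral_mult_right_zero)

lemma mean_sum:
  "(\<And>i. i \<in> A \<Longrightarrow> polynomial_fun I (f i)) \<Longrightarrow> mean (\<lambda>m. \<Sum>i\<in>A. f i m) = (\<Sum>i\<in>A. mean (f i))"
  unfolding mean_def sum_distrib_right
  by (intro Bochner_Integration.integral_sum integrable_polynomial)

lemma mean_const: "mean (\<lambda>m. c) = c"
proof -
  have "moment p 0 = 1" for p
    using integral_normal_moment_even[OF scale_pos[of p], of 0 0] by (simp add: moment_def)
  then have "mean (coordinate_monomial I (\<lambda>_. 0)) = 1"
    by (simp add: mean_monomial)
  then show ?thesis
    using mean_scale[of c "coordinate_monomial I (\<lambda>_. 0)"]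
    by (simp add: coordinate_monomial_def)
qed

text \<open>Multiplying by the coordinate p changes only the exponent at p. The moments of the
  remaining coordinates split off as the common factor \<open>R\<close>, leaving the one-variable
  recursion.\<close>

lemma stein_monomial:
  assumes "p \<in> I"
  shows "mean (\<lambda>m. of_real (m p) * coordinate_monomial I n m) =
    of_real ((s p)\<^sup>2) * mean (\<lambda>m. of_nat (n p) * coordinate_monomial I (n(p := n p - 1)) m)"
proof -
  define R where "R = (\<Prod>q\<in>I - {p}. moment q (n q))"
  have "of_real (m p) * coordinate_monomial I n m = coordinate_monomial I (n(p := Suc (n p))) m"
    for m :: "'i \<Rightarrow> real"
    using assms finite_index by (simp add: coordinate_monomial_def prod.remove[of I p])
  then have "mean (\<lambda>m. of_real (m p) * coordinate_monomial I n m) =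
    of_real (moment p (Suc (n p)) * R)"
    using assms finite_index by (simp add: mean_monomial R_def prod.remove[of I p])
  moreover have "mean (\<lambda>m. of_nat (n p) * coordinate_monomial I (n(p := n p - 1)) m) =
    of_real (of_nat (n p) * moment p (n p - 1) * R)"
    using assms finite_index by (simp add: mean_scale mean_monomial R_def prod.remove[of I p])
  moreover have "moment p (Suc (n p)) = real (n p) * (s p)\<^sup>2 * moment p (n p - 1)"
    unfolding moment_def by (rule normal_moment_Suc) (rule scale_pos)
  ultimately show ?thesis by simp
qed

text \<open>The derivative is existentially quantified because a polynomial function does not carry
  a chosen one; the induction over monomials constructs it together with the identity.\<close>

lemma stein_exists:
  assumes "polynomial_fun I f" "p \<in> I"
  shows "\<exists>g. polynomial_fun I g \<and> has_partial p f g \<and>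
    mean (\<lambda>m. of_real (m p) * f m) = of_real ((s p)\<^sup>2) * mean g"
  using assms(1)
proof (induction rule: polynomial_fun.induct)
  case zero
  show ?case
    by (rule exI[of _ "\<lambda>m. 0"]) (simp add: polynomial_fun.zero has_partial_const mean_const)
next
  case (step f c n)
  then obtain g where g: "polynomial_fun I g" "has_partial p f g"
    "mean (\<lambda>m. of_real (m p) * f m) = of_real ((s p)\<^sup>2) * mean g" by blast
  define d where "d m = of_nat (n p) * coordinate_monomial I (n(p := n p - 1)) m" for m
  have poly: "polynomial_fun I (coordinate_monomial I n)" "polynomial_fun I d"
    "polynomial_fun I (\<lambda>m. of_real (m p))"
    using polynomial_fun_monomial[of I 1] polynomial_fun_coordinate[OF finite_index assms(2)]
    by (simp_all add: d_def[abs_def] polynomial_fun_monomial)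
  have "polynomial_fun I (\<lambda>m. c * d m + g m)"
    by (intro polynomial_fun_add polynomial_fun_mult polynomial_fun_const poly g)
  moreover have "has_partial p (\<lambda>m. c * coordinate_monomial I n m + f m) (\<lambda>m. c * d m + g m)"
    using has_partial_add[OF has_partial_mult[OF has_partial_const
          has_partial_monomial[OF finite_index assms(2)]] g(2), of c n]
    by (simp add: d_def)
  moreover have "mean (\<lambda>m. of_real (m p) * (c * coordinate_monomial I n m + f m)) =
    of_real ((s p)\<^sup>2) * mean (\<lambda>m. c * d m + g m)"
  proof -
    have "mean (\<lambda>m. of_real (m p) * (c * coordinate_monomial I n m + f m)) =
      mean (\<lambda>m. c * (of_real (m p) * coordinate_monomial I n m) + of_real (m p) * f m)"
      by (simp add: algebra_simps)
    also have "\<dots> = c * mean (\<lambda>m. of_real (m p) * coordinate_monomial I n m) +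
      mean (\<lambda>m. of_real (m p) * f m)"
      using mean_add[of "\<lambda>m. c * (of_real (m p) * coordinate_monomial I n m)" "\<lambda>m. of_real (m p) * f m"]
      by (simp add: polynomial_fun_mult polynomial_fun_const poly step.hyps mean_scale)
    also have "\<dots> = of_real ((s p)\<^sup>2) * (c * mean d + mean g)"
      unfolding stein_monomial[OF assms(2)] g(3) d_def[abs_def] by (simp only: algebra_simps)
    also have "c * mean d + mean g = mean (\<lambda>m. c * d m + g m)"
      using mean_add[of "\<lambda>m. c * d m" g]
      by (simp add: polynomial_fun_mult polynomial_fun_const poly g mean_scale)
    finally show ?thesis .
  qed
  ultimately show ?case by blast
qed

lemma
  assumes "polynomial_fun I f" "p \<in> I" "has_partial p f g"
  shows polynomial_partial: "polynomial_fun I g"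
    and stein: "mean (\<lambda>m. of_real (m p) * f m) = of_real ((s p)\<^sup>2) * mean g"
  using stein_exists[OF assms(1,2)] has_partial_unique[OF assms(3)] by blast+

end

section \<open>Moments of Hermitian Gaussian matrices\<close>

text \<open>Standard deviations of the coordinates under exp(- Tr X^2 / 2). Each off-diagonal entry
  and its conjugate both contribute to Tr X^2, so its real and imaginary parts have variance 1/2,
  while diagonal entries have variance 1.\<close>

definition entry_scale :: "nat \<times> nat \<Rightarrow> real" where
  "entry_scale p = (if fst p = snd p then 1 else sqrt (1 / 2))"

text \<open>The matrix entry at (a, b) is \<open>entry_coeff_row a b\<close> times the coordinate at
  (a, b) plus \<open>entry_coeff_col a b\<close> times that at (b, a). On the diagonal the two
  coordinates coincide, and the second coefficient is 0.\<close>

definition entry_coeff_row :: "nat \<Rightarrow> nat \<Rightarrow> complex" where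
  "entry_coeff_row a b = (if a \<le> b then 1 else - \<i>)"

definition entry_coeff_col :: "nat \<Rightarrow> nat \<Rightarrow> complex" where
  "entry_coeff_col a b = (if a < b then \<i> else if a = b then 0 else 1)"

section \<open>Matrix entries and traces as polynomial functions\<close>

locale gue =
  fixes N :: nat
begin

sublocale gaussian_family "{..<N} \<times> {..<N}" entry_scale
  by unfold_locales (auto simp: entry_scale_def)

abbreviation poly_fun :: "((nat \<times> nat \<Rightarrow> real) \<Rightarrow> complex) \<Rightarrow> bool" where
  "poly_fun \<equiv> polynomial_fun ({..<N} \<times> {..<N})"

definition power_entry :: "nat \<Rightarrow> nat \<Rightarrow> nat \<Rightarrow> (nat \<times> nat \<Rightarrow> real) \<Rightarrow> complex" where
  "power_entry k a b m = (hermitian_of_coords N m ^\<^sub>m k) $$ (a, b)"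

definition entry :: "nat \<Rightarrow> nat \<Rightarrow> (nat \<times> nat \<Rightarrow> real) \<Rightarrow> complex" where
  "entry a b m = entry_coeff_row a b * of_real (m (a, b)) + entry_coeff_col a b * of_real (m (b, a))"

definition trace_power :: "nat \<Rightarrow> (nat \<times> nat \<Rightarrow> real) \<Rightarrow> complex" where
  "trace_power k m = (\<Sum>a<N. power_entry k a a m)"

definition trace_product :: "nat list \<Rightarrow> (nat \<times> nat \<Rightarrow> real) \<Rightarrow> complex" where
  "trace_product ks m = (\<Prod>k\<leftarrow>ks. trace_power k m)"

lemma hermitian_of_coords_carrier: "hermitian_of_coords N m \<in> carrier_mat N N"
  by (simp add: hermitian_of_coords_def)

lemma hermitian_of_coords_entry:
  "a < N \<Longrightarrow> b < N \<Longrightarrow> hermitian_of_coords N m $$ (a, b) = entry a b m"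
  by (auto simp: hermitian_of_coords_def entry_def entry_coeff_row_def entry_coeff_col_def
      complex_eq_iff)

lemma power_entry_0:
  "a < N \<Longrightarrow> b < N \<Longrightarrow> power_entry 0 a b m = (if a = b then 1 else 0)"
  using hermitian_of_coords_carrier[of m] by (simp add: power_entry_def)

lemma power_entry_Suc:
  assumes "a < N" "b < N"
  shows "power_entry (Suc k) a b m = (\<Sum>c<N. power_entry k a c m * entry c b m)"
proof -
  let ?H = "hermitian_of_coords N m"
  have "?H \<in> carrier_mat N N" "?H ^\<^sub>m k \<in> carrier_mat N N"
    by (auto intro: hermitian_of_coords_carrier pow_carrier_mat)
  then have "(?H ^\<^sub>m k * ?H) $$ (a, b) = (\<Sum>c\<in>{0..<N}. (?H ^\<^sub>m k) $$ (a, c) * ?H $$ (c, b))"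
    using assms by (auto simp: scalar_prod_def intro!: sum.cong)
  then show ?thesis
    using assms by (simp add: power_entry_def hermitian_of_coords_entry atLeast0LessThan)
qed

lemma power_entry_add:
  assumes "a < N" "b < N"
  shows "power_entry (j + k) a b m = (\<Sum>c<N. power_entry j a c m * power_entry k c b m)"
  using assms(2)
proof (induction k arbitrary: b)
  case 0
  then show ?case
    by (subst sum_eq_at[of _ b]) (auto simp: power_entry_0)
next
  case (Suc k)
  have "power_entry (j + Suc k) a b m =
    (\<Sum>e<N. (\<Sum>c<N. power_entry j a c m * power_entry k c e m) * entry e b m)"
    using Suc assms(1) by (simp add: power_entry_Suc)
  also have "\<dots> = (\<Sum>c<N. \<Sum>e<N. power_entry j a c m * power_entry k c e m * entry e b m)"
    by (subst sum.swap) (simp add: sum_distrib_right)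
  also have "\<dots> = (\<Sum>c<N. power_entry j a c m * power_entry (Suc k) c b m)"
    using Suc.prems by (simp add: power_entry_Suc sum_distrib_left mult.assoc)
  finally show ?case .
qed

lemma mat_trace_power: "mat_trace (hermitian_of_coords N m ^\<^sub>m k) = trace_power k m"
  using hermitian_of_coords_carrier[of m]
  by (simp add: mat_trace_def trace_power_def power_entry_def)

lemma poly_fun_entry: "a < N \<Longrightarrow> b < N \<Longrightarrow> poly_fun (entry a b)"
  unfolding entry_def[abs_def]
  by (intro polynomial_fun_add polynomial_fun_mult polynomial_fun_const polynomial_fun_coordinate) auto

lemma poly_fun_power_entry: "a < N \<Longrightarrow> b < N \<Longrightarrow> poly_fun (power_entry k a b)"
proof (induction k arbitrary: b)
  case 0
  then have "power_entry 0 a b = (\<lambda>m. if a = b then 1 else 0)"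
    by (intro ext power_entry_0)
  then show ?case
    by (simp add: polynomial_fun_const)
next
  case (Suc k)
  then have "power_entry (Suc k) a b = (\<lambda>m. \<Sum>c<N. power_entry k a c m * entry c b m)"
    by (intro ext power_entry_Suc)
  then show ?case
    using Suc by (auto intro!: polynomial_fun_sum polynomial_fun_mult poly_fun_entry)
qed

lemma poly_fun_trace_power: "poly_fun (trace_power k)"
  unfolding trace_power_def[abs_def] by (auto intro!: polynomial_fun_sum poly_fun_power_entry)

lemma poly_fun_trace_product: "poly_fun (trace_product ks)"
proof (induction ks)
  case Nil
  show ?case
    using polynomial_fun_const by (simp add: trace_product_def[abs_def])
next
  case (Cons k ks)
  then show ?case
    using polynomial_fun_mult[OF poly_fun_trace_power, of _ k]
    by (simp add: trace_product_def[abs_def])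
qed

text \<open>
  \<open>entry_deriv a b\<close> is the derivative along the matrix entry \<open>(b, a)\<close>, normalised such that
  Gaussian integration by parts turns multiplication by the entry \<open>(a, b)\<close> into it.
\<close>

definition entry_deriv :: "nat \<Rightarrow> nat \<Rightarrow> ((nat \<times> nat \<Rightarrow> real) \<Rightarrow> complex) \<Rightarrow>
    ((nat \<times> nat \<Rightarrow> real) \<Rightarrow> complex) \<Rightarrow> bool" where
  "entry_deriv a b f g \<longleftrightarrow> (\<exists>g1 g2. has_partial (a, b) f g1 \<and> has_partial (b, a) f g2 \<and>
     g = (\<lambda>m. of_real ((entry_scale (a, b))\<^sup>2) *
       (entry_coeff_row a b * g1 m + entry_coeff_col a b * g2 m)))"

lemma entry_derivI:
  assumes "has_partial (a, b) f g1" "has_partial (b, a) f g2"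
    "\<And>m. g m = of_real ((entry_scale (a, b))\<^sup>2) *
       (entry_coeff_row a b * g1 m + entry_coeff_col a b * g2 m)"
  shows "entry_deriv a b f g"
  unfolding entry_deriv_def using assms by blast

lemma entry_deriv_const: "entry_deriv a b (\<lambda>m. c) (\<lambda>m. 0)"
  by (rule entry_derivI[OF has_partial_const has_partial_const]) simp

lemma entry_derivE:
  assumes "entry_deriv a b f g"
  obtains g1 g2 where "has_partial (a, b) f g1" "has_partial (b, a) f g2"
    "\<And>m. g m = of_real ((entry_scale (a, b))\<^sup>2) *
       (entry_coeff_row a b * g1 m + entry_coeff_col a b * g2 m)"
  using assms unfolding entry_deriv_def by auto

lemma entry_deriv_add:
  assumes "entry_deriv a b f f'" "entry_deriv a b g g'"
  shows "entry_deriv a b (\<lambda>m. f m + g m) (\<lambda>m. f' m + g' m)"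
proof (rule entry_derivE[OF assms(1)], rule entry_derivE[OF assms(2)])
  fix f1 f2 g1 g2
  assume f: "has_partial (a, b) f f1" "has_partial (b, a) f f2"
    and g: "has_partial (a, b) g g1" "has_partial (b, a) g g2"
    and eq: "\<And>m. f' m = of_real ((entry_scale (a, b))\<^sup>2) *
        (entry_coeff_row a b * f1 m + entry_coeff_col a b * f2 m)"
      "\<And>m. g' m = of_real ((entry_scale (a, b))\<^sup>2) *
        (entry_coeff_row a b * g1 m + entry_coeff_col a b * g2 m)"
  show ?thesis
    by (rule entry_derivI[OF has_partial_add[OF f(1) g(1)] has_partial_add[OF f(2) g(2)]])
      (simp only: eq algebra_simps)
qed

lemma entry_deriv_mult:
  assumes "entry_deriv a b f f'" "entry_deriv a b g g'"
  shows "entry_deriv a b (\<lambda>m. f m * g m) (\<lambda>m. f m * g' m + f' m * g m)"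
proof (rule entry_derivE[OF assms(1)], rule entry_derivE[OF assms(2)])
  fix f1 f2 g1 g2
  assume f: "has_partial (a, b) f f1" "has_partial (b, a) f f2"
    and g: "has_partial (a, b) g g1" "has_partial (b, a) g g2"
    and eq: "\<And>m. f' m = of_real ((entry_scale (a, b))\<^sup>2) *
        (entry_coeff_row a b * f1 m + entry_coeff_col a b * f2 m)"
      "\<And>m. g' m = of_real ((entry_scale (a, b))\<^sup>2) *
        (entry_coeff_row a b * g1 m + entry_coeff_col a b * g2 m)"
  show ?thesis
    by (rule entry_derivI[OF has_partial_mult[OF f(1) g(1)] has_partial_mult[OF f(2) g(2)]])
      (simp only: eq algebra_simps)
qed

lemma entry_deriv_sum:
  "(\<And>i. i \<in> A \<Longrightarrow> entry_deriv a b (f i) (f' i)) \<Longrightarrow>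
    entry_deriv a b (\<lambda>m. \<Sum>i\<in>A. f i m) (\<lambda>m. \<Sum>i\<in>A. f' i m)"
  by (induction A rule: infinite_finite_induct)
    (auto intro: entry_deriv_add entry_deriv_const)

text \<open>This is the covariance of the ensemble: X_ab pairs only with X_ba. Off the diagonal,
  pairing with X_ba gives 1/2 * (1 + 1), and pairing X_ab with itself gives 1/2 * (1 + \<i>^2) =
  0.\<close>

lemma entry_deriv_entry:
  "entry_deriv a b (entry c d) (\<lambda>m. if c = b \<and> d = a then 1 else 0)"
proof -
  have linear: "has_partial p (\<lambda>m. k * of_real (m q)) (\<lambda>m. k * (if p = q then 1 else 0))"
    for p q :: "nat \<times> nat" and k
    using has_partial_mult[OF has_partial_const[of p k] has_partial_coordinate[of p q]]
    by (simp only: mult_zero_left add_0_right)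
  have partial: "has_partial p (entry c d) (\<lambda>m.
      entry_coeff_row c d * (if p = (c, d) then 1 else 0) +
      entry_coeff_col c d * (if p = (d, c) then 1 else 0))" for p
    unfolding entry_def[abs_def] by (intro has_partial_add linear)
  show ?thesis
  proof (rule entry_derivI[OF partial partial])
    fix m
    consider "c = b" "d = a" | "c = a" "d = b" "a \<noteq> b" | "(c, d) \<noteq> (a, b)" "(c, d) \<noteq> (b, a)"
      by blast
    then show "(if c = b \<and> d = a then 1 else 0) = of_real ((entry_scale (a, b))\<^sup>2) *
      (entry_coeff_row a b * (entry_coeff_row c d * (if (a, b) = (c, d) then 1 else 0) +
        entry_coeff_col c d * (if (a, b) = (d, c) then 1 else 0)) +
      entry_coeff_col a b * (entry_coeff_row c d * (if (b, a) = (c, d) then 1 else 0) +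
        entry_coeff_col c d * (if (b, a) = (d, c) then 1 else 0)))"
    proof cases
      case 1
      then show ?thesis
        by (cases a b rule: linorder_cases)
          (simp_all add: entry_coeff_row_def entry_coeff_col_def entry_scale_def power_divide)
    next
      case 2
      then show ?thesis
        by (cases a b rule: linorder_cases)
          (simp_all add: entry_coeff_row_def entry_coeff_col_def)
    next
      case 3
      then have "\<not> (c = b \<and> d = a)" "(a, b) \<noteq> (c, d)" "(a, b) \<noteq> (d, c)"
        "(b, a) \<noteq> (c, d)" "(b, a) \<noteq> (d, c)"
        by blast+
      then show ?thesis
        by (simp only: if_False mult_zero_right add_0_right)
    qed
  qed
qed

text \<open>Integration by parts in the coordinates at (a, b) and (b, a), combined linearly. Their
  variances agree, so the variance comes out as a common factor.\<close>

lemma mean_entry_mult: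
  assumes "poly_fun f" "entry_deriv a b f g" "a < N" "b < N"
  shows "mean (\<lambda>m. entry a b m * f m) = mean g"
proof -
  obtain g1 g2 where g: "has_partial (a, b) f g1" "has_partial (b, a) f g2"
    "g = (\<lambda>m. of_real ((entry_scale (a, b))\<^sup>2) *
       (entry_coeff_row a b * g1 m + entry_coeff_col a b * g2 m))"
    using assms(2) by (auto simp: entry_deriv_def)
  have ab: "(a, b) \<in> {..<N} \<times> {..<N}" "(b, a) \<in> {..<N} \<times> {..<N}" using assms by auto
  have poly: "poly_fun g1" "poly_fun g2"
    by (rule polynomial_partial[OF assms(1) ab(1) g(1)], rule polynomial_partial[OF assms(1) ab(2) g(2)])
  have coord: "poly_fun (\<lambda>m. of_real (m (a, b)))" "poly_fun (\<lambda>m. of_real (m (b, a)))"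
    using ab by (auto intro: polynomial_fun_coordinate)
  have "mean (\<lambda>m. entry a b m * f m) =
    mean (\<lambda>m. entry_coeff_row a b * (of_real (m (a, b)) * f m) +
      entry_coeff_col a b * (of_real (m (b, a)) * f m))"
    by (simp add: entry_def algebra_simps)
  also have "\<dots> = entry_coeff_row a b * mean (\<lambda>m. of_real (m (a, b)) * f m) +
    entry_coeff_col a b * mean (\<lambda>m. of_real (m (b, a)) * f m)"
    using mean_add[of "\<lambda>m. entry_coeff_row a b * (of_real (m (a, b)) * f m)"
      "\<lambda>m. entry_coeff_col a b * (of_real (m (b, a)) * f m)"]
    by (simp add: polynomial_fun_mult polynomial_fun_const coord assms(1) mean_scale)
  also have "\<dots> = of_real ((entry_scale (a, b))\<^sup>2) *
      (entry_coeff_row a b * mean g1 + entry_coeff_col a b * mean g2)"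
  proof -
    have "entry_scale (b, a) = entry_scale (a, b)" by (simp add: entry_scale_def)
    then show ?thesis
      unfolding stein[OF assms(1) ab(1) g(1)] stein[OF assms(1) ab(2) g(2)]
      by (simp only: algebra_simps)
  qed
  also have "\<dots> = mean g"
    using mean_add[of "\<lambda>m. entry_coeff_row a b * g1 m" "\<lambda>m. entry_coeff_col a b * g2 m"]
    by (simp add: g(3) polynomial_fun_mult polynomial_fun_const poly mean_scale)
  finally show ?thesis .
qed

text \<open>In the product of k matrices, the factor after the first r is replaced by the elementary
  matrix with entry 1 at (b, a), which cuts the product into the two powers shown. The induction
  splits off the last factor, whose own derivative is the term r = k.\<close>

lemma entry_deriv_power_entry:
  assumes "a < N" "b < N" "c < N" "d < N"
  shows "entry_deriv a b (power_entry k c d)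
    (\<lambda>m. \<Sum>r<k. power_entry r c b m * power_entry (k - Suc r) a d m)"
  using assms(4)
proof (induction k arbitrary: d)
  case 0
  with assms have "power_entry 0 c d = (\<lambda>m. if c = d then 1 else 0)"
    by (intro ext power_entry_0)
  then show ?case
    by (simp add: entry_deriv_const)
next
  case (Suc k)
  have deriv: "entry_deriv a b (\<lambda>m. \<Sum>e<N. power_entry k c e m * entry e d m)
    (\<lambda>m. \<Sum>e<N. power_entry k c e m * (if e = b \<and> d = a then 1 else 0) +
      (\<Sum>r<k. power_entry r c b m * power_entry (k - Suc r) a e m) * entry e d m)"
    using Suc by (intro entry_deriv_sum entry_deriv_mult entry_deriv_entry) auto
  have "(\<Sum>e<N. power_entry k c e m * (if e = b \<and> d = a then 1 else 0)) =
    power_entry k c b m * power_entry 0 a d m" for m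
    using assms Suc.prems by (subst sum_eq_at[of _ b]) (auto simp: power_entry_0)
  moreover have "(\<Sum>e<N. (\<Sum>r<k. power_entry r c b m * power_entry (k - Suc r) a e m) *
      entry e d m) = (\<Sum>r<k. power_entry r c b m * power_entry (k - r) a d m)" for m
  proof -
    have "(\<Sum>e<N. (\<Sum>r<k. power_entry r c b m * power_entry (k - Suc r) a e m) * entry e d m) =
      (\<Sum>r<k. \<Sum>e<N. power_entry r c b m * power_entry (k - Suc r) a e m * entry e d m)"
      by (subst sum.swap) (simp add: sum_distrib_right)
    also have "\<dots> = (\<Sum>r<k. power_entry r c b m * power_entry (Suc (k - Suc r)) a d m)"
      using assms Suc.prems by (simp add: power_entry_Suc sum_distrib_left mult.assoc)
    also have "\<dots> = (\<Sum>r<k. power_entry r c b m * power_entry (k - r) a d m)"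
      by (intro sum.cong refl) (simp add: Suc_diff_Suc)
    finally show ?thesis .
  qed
  moreover have "power_entry (Suc k) c d = (\<lambda>m. \<Sum>e<N. power_entry k c e m * entry e d m)"
    using assms Suc.prems by (intro ext power_entry_Suc)
  ultimately show ?case
    using deriv by (simp add: sum.distrib add.commute)
qed

text \<open>Summing over the diagonal glues the two powers together in the opposite order, so all k
  terms become the same power of exponent k - 1.\<close>

lemma entry_deriv_trace_power:
  assumes "a < N" "b < N"
  shows "entry_deriv a b (trace_power k) (\<lambda>m. of_nat k * power_entry (k - 1) a b m)"
proof -
  have "entry_deriv a b (trace_power k)
    (\<lambda>m. \<Sum>c<N. \<Sum>r<k. power_entry r c b m * power_entry (k - Suc r) a c m)"
    unfolding trace_power_def[abs_def]
    using assms by (intro entry_deriv_sum entry_deriv_power_entry) auto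
  moreover have "(\<Sum>c<N. \<Sum>r<k. power_entry r c b m * power_entry (k - Suc r) a c m) =
    of_nat k * power_entry (k - 1) a b m" for m
  proof -
    have "(\<Sum>c<N. \<Sum>r<k. power_entry r c b m * power_entry (k - Suc r) a c m) =
      (\<Sum>r<k. \<Sum>c<N. power_entry (k - Suc r) a c m * power_entry r c b m)"
      by (subst sum.swap) (simp only: mult.commute)
    also have "\<dots> = (\<Sum>r<k. power_entry (k - Suc r + r) a b m)"
      by (simp only: power_entry_add[OF assms])
    also have "\<dots> = (\<Sum>r<k. power_entry (k - 1) a b m)"
      by (intro sum.cong refl) simp
    finally show ?thesis by simp
  qed
  ultimately show ?thesis by simp
qed

lemma trace_product_simps [simp]:
  "trace_product [] m = 1"
  "trace_product (k # ks) m = trace_power k m * trace_product ks m"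
  by (simp_all add: trace_product_def)

lemma entry_deriv_trace_product:
  assumes "a < N" "b < N"
  shows "entry_deriv a b (trace_product ks) (\<lambda>m. \<Sum>i<length ks.
    of_nat (ks ! i) * power_entry (ks ! i - 1) a b m * trace_product (remove_at i ks) m)"
proof (induction ks)
  case Nil
  show ?case
    using entry_deriv_const[of a b 1] by (simp add: trace_product_def[abs_def])
next
  case (Cons k ks)
  have eq: "trace_product (k # ks) = (\<lambda>m. trace_power k m * trace_product ks m)"
    by (simp add: fun_eq_iff)
  show ?case
    unfolding eq
    using entry_deriv_mult[OF entry_deriv_trace_power[OF assms, of k] Cons]
    by (simp add: sum.lessThan_Suc_shift remove_at_def sum_distrib_left algebra_simps
        del: sum.lessThan_Suc)
qed

lemma loop_equation_mean:
  "mean (trace_product (Suc n # ks)) = (\<Sum>r<n. mean (trace_product (r # (n - Suc r) # ks))) +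
     (\<Sum>i<length ks. of_nat (ks ! i) * mean (trace_product ((ks ! i - 1 + n) # remove_at i ks)))"
proof -
  \<comment> \<open>\<open>F a b\<close> is the cofactor of the last factor X_ab in Tr X^(n+1) times
    the other traces, and \<open>G a b\<close> is its derivative: first the terms that differentiate
    another trace, then those that differentiate X^n.\<close>
  define F where "F a b m = power_entry n b a m * trace_product ks m" for a b m
  define G where "G a b m = power_entry n b a m * (\<Sum>i<length ks.
      of_nat (ks ! i) * power_entry (ks ! i - 1) a b m * trace_product (remove_at i ks) m) +
    (\<Sum>r<n. power_entry r b b m * power_entry (n - Suc r) a a m) * trace_product ks m" for a b m
  have polyF: "poly_fun (F a b)" if "a < N" "b < N" for a b
    unfolding F_def[abs_def]
    using that by (intro polynomial_fun_mult poly_fun_power_entry poly_fun_trace_product)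
  have polyG: "poly_fun (G a b)" if "a < N" "b < N" for a b
    unfolding G_def[abs_def]
    using that by (intro polynomial_fun_add polynomial_fun_mult polynomial_fun_sum
        polynomial_fun_const poly_fun_power_entry poly_fun_trace_product)
  have deriv: "entry_deriv a b (F a b) (G a b)" if "a < N" "b < N" for a b
    unfolding F_def[abs_def] G_def[abs_def]
    using that by (intro entry_deriv_mult entry_deriv_power_entry entry_deriv_trace_product)
  have "trace_product (Suc n # ks) m = (\<Sum>b<N. \<Sum>a<N. entry a b m * F a b m)" for m
    by (simp add: trace_power_def power_entry_Suc F_def sum_distrib_right sum_distrib_left mult_ac)
  then have "mean (trace_product (Suc n # ks)) = mean (\<lambda>m. \<Sum>b<N. \<Sum>a<N. entry a b m * F a b m)"
    by presburger
  also have "\<dots> = (\<Sum>b<N. mean (\<lambda>m. \<Sum>a<N. entry a b m * F a b m))"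
    by (intro mean_sum polynomial_fun_sum polynomial_fun_mult poly_fun_entry polyF) auto
  also have "\<dots> = (\<Sum>b<N. \<Sum>a<N. mean (\<lambda>m. entry a b m * F a b m))"
    by (intro sum.cong refl mean_sum polynomial_fun_mult poly_fun_entry polyF) auto
  also have "\<dots> = (\<Sum>b<N. \<Sum>a<N. mean (G a b))"
    by (intro sum.cong refl mean_entry_mult polyF deriv) auto
  also have "\<dots> = (\<Sum>b<N. mean (\<lambda>m. \<Sum>a<N. G a b m))"
    by (intro sum.cong refl mean_sum[symmetric] polyG) auto
  also have "\<dots> = mean (\<lambda>m. \<Sum>b<N. \<Sum>a<N. G a b m)"
    by (intro mean_sum[symmetric] polynomial_fun_sum polyG) auto
  also have "(\<lambda>m. \<Sum>b<N. \<Sum>a<N. G a b m) =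
    (\<lambda>m. (\<Sum>r<n. trace_product (r # (n - Suc r) # ks) m) +
      (\<Sum>i<length ks. of_nat (ks ! i) * trace_product ((ks ! i - 1 + n) # remove_at i ks) m))"
  proof
    fix m
    \<comment> \<open>The sum over a multiplies X^n by a power of X from another trace, and the sum
      over b closes the product to a single trace.\<close>
    have "(\<Sum>b<N. \<Sum>a<N. power_entry n b a m * (\<Sum>i<length ks.
        of_nat (ks ! i) * power_entry (ks ! i - 1) a b m * trace_product (remove_at i ks) m)) =
      (\<Sum>b<N. \<Sum>i<length ks. \<Sum>a<N. of_nat (ks ! i) * trace_product (remove_at i ks) m *
        (power_entry n b a m * power_entry (ks ! i - 1) a b m))"
      by (subst (2) sum.swap) (simp add: sum_distrib_left mult_ac)
    also have "\<dots> = (\<Sum>i<length ks. \<Sum>b<N. of_nat (ks ! i) * trace_product (remove_at i ks) m *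
        power_entry (n + (ks ! i - 1)) b b m)"
      by (subst sum.swap) (simp add: sum_distrib_left power_entry_add)
    also have "\<dots> = (\<Sum>i<length ks. of_nat (ks ! i) *
        trace_product ((ks ! i - 1 + n) # remove_at i ks) m)"
      by (simp add: trace_power_def sum_distrib_left add.commute mult_ac)
    finally have 1: "(\<Sum>b<N. \<Sum>a<N. power_entry n b a m * (\<Sum>i<length ks.
        of_nat (ks ! i) * power_entry (ks ! i - 1) a b m * trace_product (remove_at i ks) m)) =
      (\<Sum>i<length ks. of_nat (ks ! i) * trace_product ((ks ! i - 1 + n) # remove_at i ks) m)" .
    \<comment> \<open>Here a and b occur in different factors, so the double sum separates into a
      product of two traces.\<close>
    have "(\<Sum>b<N. \<Sum>a<N. (\<Sum>r<n. power_entry r b b m * power_entry (n - Suc r) a a m) *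
        trace_product ks m) =
      (\<Sum>b<N. \<Sum>r<n. \<Sum>a<N. power_entry r b b m * power_entry (n - Suc r) a a m *
        trace_product ks m)"
      by (subst (2) sum.swap) (simp add: sum_distrib_right)
    also have "\<dots> = (\<Sum>r<n. \<Sum>b<N. \<Sum>a<N.
        power_entry r b b m * power_entry (n - Suc r) a a m * trace_product ks m)"
      by (rule sum.swap)
    also have "\<dots> = (\<Sum>r<n. trace_product (r # (n - Suc r) # ks) m)"
      by (simp only: trace_product_simps mult.assoc[symmetric] trace_power_def,
          simp only: sum_product, simp only: sum_distrib_right)
    finally have 2: "(\<Sum>b<N. \<Sum>a<N. (\<Sum>r<n. power_entry r b b m *
        power_entry (n - Suc r) a a m) * trace_product ks m) =
      (\<Sum>r<n. trace_product (r # (n - Suc r) # ks) m)" .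
    show "(\<Sum>b<N. \<Sum>a<N. G a b m) = (\<Sum>r<n. trace_product (r # (n - Suc r) # ks) m) +
      (\<Sum>i<length ks. of_nat (ks ! i) * trace_product ((ks ! i - 1 + n) # remove_at i ks) m)"
      unfolding G_def sum.distrib 1 2 by (rule add.commute)
  qed
  also have "mean \<dots> = (\<Sum>r<n. mean (trace_product (r # (n - Suc r) # ks))) +
     (\<Sum>i<length ks. of_nat (ks ! i) * mean (trace_product ((ks ! i - 1 + n) # remove_at i ks)))"
  proof -
    have poly: "poly_fun (trace_product ls)" "poly_fun (\<lambda>m. of_nat k * trace_product ls m)" for k ls
      by (intro polynomial_fun_mult polynomial_fun_const poly_fun_trace_product)+
    show ?thesis
      by (simp only: mean_add[OF polynomial_fun_sum polynomial_fun_sum] mean_sum poly mean_scale)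
  qed
  finally show ?thesis .
qed

lemma mean_trace_product_replicate_0: "mean (trace_product (replicate k 0)) = of_nat N ^ k"
proof -
  have "trace_product (replicate k 0) = (\<lambda>m. of_nat N ^ k)"
    by (simp add: fun_eq_iff trace_product_def trace_power_def power_entry_0 prod_list_replicate)
  then show ?thesis by (simp add: mean_const)
qed

section \<open>From the Gaussian weight on matrices to independent normal coordinates\<close>

lemma trace_square_eq:
  "mat_trace (hermitian_of_coords N m ^\<^sub>m 2) =
    of_real (\<Sum>p\<in>{..<N} \<times> {..<N}. (m p)\<^sup>2 / (entry_scale p)\<^sup>2)"
proof -
  \<comment> \<open>Symmetrising in a and b removes the distinction between real and imaginary
    parts: X_ab X_ba is the average of \<open>q a b\<close> and \<open>q b a\<close>, both on and
    off the diagonal.\<close>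
  define q where "q a b = (m (a, b))\<^sup>2 / (entry_scale (a, b))\<^sup>2" for a b
  have entry: "entry a b m * entry b a m = of_real ((q a b + q b a) / 2)" for a b
    by (cases a b rule: linorder_cases)
      (auto simp: entry_def entry_coeff_row_def entry_coeff_col_def entry_scale_def q_def
        power_divide complex_eq_iff power2_eq_square)
  have power_entry_1: "power_entry 1 a b m = entry a b m" if "a < N" "b < N" for a b
    using that power_entry_Suc[of a b 0 m] sum_eq_at[of "{..<N}" a "\<lambda>c. power_entry 0 a c m * entry c b m"]
    by (simp add: power_entry_0)
  have "mat_trace (hermitian_of_coords N m ^\<^sub>m 2) = trace_power (1 + 1) m"
    by (simp only: mat_trace_power one_add_one)
  also have "\<dots> = (\<Sum>a<N. \<Sum>b<N. entry a b m * entry b a m)"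
  proof -
    have "power_entry (1 + 1) a a m = (\<Sum>b<N. entry a b m * entry b a m)" if "a < N" for a
      using power_entry_add[OF that that, of 1 1 m] power_entry_1 that by simp
    then show ?thesis by (simp add: trace_power_def)
  qed
  also have "\<dots> = of_real ((\<Sum>a<N. \<Sum>b<N. q a b + q b a) / 2)"
    by (simp only: entry sum_divide_distrib of_real_sum)
  also have "(\<Sum>a<N. \<Sum>b<N. q a b + q b a) = 2 * (\<Sum>a<N. \<Sum>b<N. q a b)"
    by (simp add: sum.distrib sum.swap[of "\<lambda>a b. q b a"])
  finally show ?thesis
    by (simp add: q_def sum.cartesian_product case_prod_unfold)
qed

text \<open>The product of the one-variable Gaussian integrals, which equals the denominator of
  \<open>gaussian_moment\<close>.\<close>

definition normalisation :: real where
  "normalisation = (\<Prod>p\<in>{..<N} \<times> {..<N}. sqrt (2 * pi * (entry_scale p)\<^sup>2))"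

lemma normalisation_pos: "normalisation > 0"
  unfolding normalisation_def
  by (intro prod_pos ballI real_sqrt_gt_zero mult_pos_pos zero_less_power scale_pos) simp_all

lemma gaussian_weight_eq:
  "exp (- (1 / 2) * mat_trace (hermitian_of_coords N m ^\<^sub>m 2)) = of_real normalisation * density m"
proof -
  have "exp (- (m p)\<^sup>2 / (2 * (entry_scale p)\<^sup>2)) =
    sqrt (2 * pi * (entry_scale p)\<^sup>2) * normal_density 0 (entry_scale p) (m p)" for p
    using scale_pos[of p] by (simp add: normal_density_def)
  then have "(\<Prod>p\<in>{..<N} \<times> {..<N}. exp (- (m p)\<^sup>2 / (2 * (entry_scale p)\<^sup>2))) =
    normalisation * (\<Prod>p\<in>{..<N} \<times> {..<N}. normal_density 0 (entry_scale p) (m p))"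
    by (simp add: normalisation_def prod.distrib)
  moreover have "(\<Prod>p\<in>{..<N} \<times> {..<N}. exp (- (m p)\<^sup>2 / (2 * (entry_scale p)\<^sup>2))) =
    exp (- (1 / 2) * (\<Sum>p\<in>{..<N} \<times> {..<N}. (m p)\<^sup>2 / (entry_scale p)\<^sup>2))"
    by (simp add: exp_sum[symmetric] sum_distrib_left sum_divide_distrib sum_negf)
  ultimately have eq: "exp (- (1 / 2) * (\<Sum>p\<in>{..<N} \<times> {..<N}. (m p)\<^sup>2 / (entry_scale p)\<^sup>2)) =
    normalisation * (\<Prod>p\<in>{..<N} \<times> {..<N}. normal_density 0 (entry_scale p) (m p))"
    by (simp only:)
  show ?thesis
    unfolding trace_square_eq density_def of_real_mult[symmetric] eq[symmetric]
    by (simp flip: exp_of_real)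
qed

text \<open>The measure on matrices is the image of Lebesgue measure under an injective map, so
  measurability and integral of \<open>g\<close> are both read off from its composition with the
  coordinates.\<close>

lemma integral_hermitian_lebesgue:
  assumes "poly_fun f" "\<And>m. g (hermitian_of_coords N m) = of_real normalisation * (f m * density m)"
  shows "(LINT A|hermitian_lebesgue N. g A) = of_real normalisation * mean f"
proof -
  let ?M = "Pi\<^sub>M ({..<N} \<times> {..<N}) (\<lambda>_. lborel) :: (nat \<times> nat \<Rightarrow> real) measure"
  let ?h = "hermitian_of_coords N"
  have inj: "inj_on ?h (space ?M)"
    using bij_betw_hermitian_of_coords[of N] by (simp add: bij_betw_def space_PiM)
  have "(\<lambda>m. g (?h m)) \<in> borel_measurable ?M"
    unfolding assms(2)
    using borel_measurable_integrable[OF integrable_polynomial[OF assms(1)]]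
    by (rule borel_measurable_times[OF borel_measurable_const])
  then have "(LINT A|hermitian_lebesgue N. g A) = (LINT m|?M. g (?h m))"
    unfolding hermitian_lebesgue_def
    by (subst embed_measure_eq_distr'[OF inj])
      (intro integral_distr measurable_embed_measure2' inj measurable_embed_measure1)
  then show ?thesis
    by (simp add: assms(2) mean_def)
qed

lemma gaussian_moment_eq_mean: "gaussian_moment N ks = mean (trace_product ks)"
proof -
  have "(LINT A|hermitian_lebesgue N. (\<Prod>k\<leftarrow>ks. mat_trace (A ^\<^sub>m k)) *
      exp (- (1 / 2) * mat_trace (A ^\<^sub>m 2))) = of_real normalisation * mean (trace_product ks)"
    by (rule integral_hermitian_lebesgue[OF poly_fun_trace_product])
      (subst gaussian_weight_eq, simp only: mat_trace_power trace_product_def mult_ac)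
  moreover have "(LINT A|hermitian_lebesgue N. exp (- (1 / 2) * mat_trace (A ^\<^sub>m 2))) =
      of_real normalisation * mean (\<lambda>m. 1)"
    by (rule integral_hermitian_lebesgue[OF polynomial_fun_const])
      (simp only: gaussian_weight_eq mult_1_left)
  ultimately show ?thesis
    using normalisation_pos by (simp add: gaussian_moment_def mean_const)
qed

lemma schwinger_dyson_gaussian_moment: "schwinger_dyson (gaussian_moment N)"
proof
  fix ks ls :: "nat list" assume "mset ks = mset ls"
  then have "mset (map f ks) = mset (map f ls)" for f :: "nat \<Rightarrow> complex"
    by simp
  then have "trace_product ks = trace_product ls"
    unfolding trace_product_def fun_eq_iff by (metis prod_mset_prod_list)
  then show "gaussian_moment N ks = gaussian_moment N ls"
    by (simp add: gaussian_moment_eq_mean)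
qed (simp only: gaussian_moment_eq_mean loop_equation_mean)

end

theorem proposition5p4:
  fixes ks :: "nat list" and N :: nat
  assumes "length ks \<ge> 1" and "N \<ge> 1"
  shows "poly (class_polynomial ks) (of_nat N) = gaussian_moment N ks"
  by (rule class_polynomial_eqI[OF gue.schwinger_dyson_gaussian_moment _ assms(2)])
    (simp add: gue.gaussian_moment_eq_mean gue.mean_trace_product_replicate_0)

end
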